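(* Let $A$ be a finite alphabet and let $\vartheta:A\to A^+$ be a primitive substitution of constant length. If $(X_\vartheta,\sigma)$ is infinite and has discrete spectrum, then $$1\le\underline{\mathrm{ac}}\big(\sigma|_{X_\vartheta}\big)\le\overline{\mathrm{ac}}\big(\sigma|_{X_\vartheta}\big)<\infty.$$
   Context: Let $A$ be a finite alphabet, $A^+$ the set of non-empty finite words over $A$, and $\Sigma=A^{\mathbb Z}$ with the product topology and the left shift $\sigma((x_n)_n)=(x_{n+1})_n$. A subshift is a pair $(X,\sigma)$ with $\emptyset\ne X\subseteq\Sigma$ closed and $\sigma(X)=X$; it is infinite if $X$ is an infinite set. It is minimal if $X$ has no non-empty proper closed subset $E$ with $\sigma(E)=E$. A substitution is a map $\vartheta:A\to A^+$, extended by concatenation to $A^+\to A^+$ and to $A^{\mathbb Z}\to A^{\mathbb Z}$ (with $\vartheta(x)=\dots\vartheta(x_{-1}).\vartheta(x_0)\vartheta(x_1)\dots$, the word $\vartheta(x_0)$ starting at coordinate $0$). It is primitive if for some $\ell>0$ and every $a\in A$ the word $\vartheta^\ell(a)$ contains every letter of $A$. It is of constant length $|\vartheta|=\ell$ if $\vartheta(a)\in A^\ell$ for all $a\in A$. For $\vartheta$ primitive, $X_\vartheta$ is the orbit closure $\overline{\{\sigma^k(x_0):k\in\mathbb Z\}}$ of a point $x_0\in A^{\mathbb Z}$ with $\vartheta^p(x_0)=x_0$ for some $p\in\mathbb N$, chosen so that this orbit closure is minimal; such points exist and $X_\vartheta$ does not depend on the choice. The subshift $(X_\vartheta,\sigma)$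 has a unique $\sigma$-invariant Borel probability measure $\mu$. It has (purely) discrete spectrum if $L_2(X_\vartheta,\mu)$ has an orthonormal basis of eigenfunctions, i.e. functions $\varphi$ with $\varphi\circ\sigma=\lambda\varphi$ for some $\lambda\in\mathbb C$. Amorphic complexity: let $(X,\sigma)$ be a subshift and $d$ any metric inducing the product topology on $A^{\mathbb Z}$. For $\delta>0$ put $D_\delta(x,y)=\limsup_{n\to\infty}\frac1n\#\{0\le k\le n-1: d(\sigma^k(x),\sigma^k(y))\ge\delta\}$. For $\delta>0$, $\nu\in(0,1]$ let $\mathrm{Sep}(\sigma|_X,\delta,\nu)=\sup\{\#Y: Y\subseteq X,\ D_\delta(x,y)\ge\nu \text{ for all } x\ne y\text{ in }Y\}$. The lower and upper amorphic complexity are $\underline{\mathrm{ac}}(\sigma|_X)=\sup_{\delta>0}\liminf_{\nu\to0}\frac{\log\mathrm{Sep}(\sigma|_X,\delta,\nu)}{-\log\nu}$ and $\overline{\mathrm{ac}}(\sigma|_X)=\sup_{\delta>0}\limsup_{\nu\to0}\frac{\log\mathrm{Sep}(\sigma|_X,\delta,\nu)}{-\log\nu}$, with values in $[0,\infty]$. *)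

theory Defs
  imports "HOL-Probability.Probability"
begin

text \<open>
  The alphabet is a type of sort \<open>{finite, discrete_topology}\<close>, so the library topology on
  the function type \<open>int \<Rightarrow> 'a\<close> is the product of the discrete topologies.
\<close>

section \<open>Subshifts\<close>

definition left_shift :: "(int \<Rightarrow> 'a) \<Rightarrow> int \<Rightarrow> 'a" where
  "left_shift x = (\<lambda>n. x (n + 1))"

definition is_subshift :: "(int \<Rightarrow> 'a::{finite, discrete_topology}) set \<Rightarrow> bool" where
  "is_subshift X \<longleftrightarrow> X \<noteq> {} \<and> closed X \<and> left_shift ` X = X"

definition is_minimal_subshift :: "(int \<Rightarrow> 'a::{finite, discrete_topology}) set \<Rightarrow> bool" where
  "is_minimal_subshift X \<longleftrightarrow> is_subshift X \<and>
     \<not> (\<exists>E. E \<noteq> {} \<and> E \<subset> X \<and> closed E \<and> left_shift ` E = E)"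

text \<open>The sequence \<open>\<lambda>n. x (n + k)\<close> is the image of \<open>x\<close> under the \<open>k\<close>-th power of the shift,
  for \<open>k\<close> of either sign.\<close>

definition orbit_closure :: "(int \<Rightarrow> 'a::{finite, discrete_topology}) \<Rightarrow> (int \<Rightarrow> 'a) set" where
  "orbit_closure x = closure (range (\<lambda>k n. x (n + k)))"

section \<open>Substitutions\<close>

definition is_substitution :: "('a \<Rightarrow> 'a list) \<Rightarrow> bool" where
  "is_substitution \<theta> \<longleftrightarrow> (\<forall>a. \<theta> a \<noteq> [])"

definition subst_word :: "('a \<Rightarrow> 'a list) \<Rightarrow> 'a list \<Rightarrow> 'a list" where
  "subst_word \<theta> w = concat (map \<theta> w)"

text \<open>The coordinate at which the block \<open>\<theta> (x k)\<close> starts in \<open>\<theta> x\<close>; at most one of the two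
  sums is non-empty.\<close>

definition block_start :: "('a \<Rightarrow> 'a list) \<Rightarrow> (int \<Rightarrow> 'a) \<Rightarrow> int \<Rightarrow> int" where
  "block_start \<theta> x k =
     (\<Sum>i\<in>{0..<k}. int (length (\<theta> (x i)))) - (\<Sum>i\<in>{k..<0}. int (length (\<theta> (x i))))"

definition subst_seq :: "('a \<Rightarrow> 'a list) \<Rightarrow> (int \<Rightarrow> 'a) \<Rightarrow> int \<Rightarrow> 'a" where
  "subst_seq \<theta> x n =
     (let k = (THE k. block_start \<theta> x k \<le> n \<and> n < block_start \<theta> x (k + 1))
      in \<theta> (x k) ! nat (n - block_start \<theta> x k))"

definition primitive_substitution :: "('a \<Rightarrow> 'a list) \<Rightarrow> bool" where
  "primitive_substitution \<theta> \<longleftrightarrow> (\<exists>l>0. \<forall>a. set ((subst_word \<theta> ^^ l) [a]) = UNIV)"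

definition constant_length :: "('a \<Rightarrow> 'a list) \<Rightarrow> bool" where
  "constant_length \<theta> \<longleftrightarrow> (\<exists>l. \<forall>a. length (\<theta> a) = l)"

text \<open>\<open>X\<close> is the subshift of \<open>\<theta>\<close>, obtained from an arbitrary admissible choice of the
  \<open>\<theta>\<close>-periodic point. For primitive \<open>\<theta>\<close> there is exactly one such \<open>X\<close>.\<close>

definition substitution_subshift ::
    "('a::{finite, discrete_topology} \<Rightarrow> 'a list) \<Rightarrow> (int \<Rightarrow> 'a) set \<Rightarrow> bool" where
  "substitution_subshift \<theta> X \<longleftrightarrow>
     (\<exists>x0 p. p > 0 \<and> (subst_seq \<theta> ^^ p) x0 = x0 \<and> X = orbit_closure x0 \<and> is_minimal_subshift X)"

section \<open>Discrete spectrum\<close>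

definition invariant_prob ::
    "(int \<Rightarrow> 'a::{finite, discrete_topology}) set \<Rightarrow> (int \<Rightarrow> 'a) measure \<Rightarrow> bool" where
  "invariant_prob X \<mu> \<longleftrightarrow> prob_space \<mu> \<and> sets \<mu> = sets (restrict_space borel X) \<and>
     left_shift \<in> measurable \<mu> \<mu> \<and> distr \<mu> \<mu> left_shift = \<mu>"

text \<open>Elements of \<open>L\<^sub>2\<close> are represented by functions, with equality almost everywhere.\<close>

definition L2 :: "'b measure \<Rightarrow> ('b \<Rightarrow> complex) set" where
  "L2 \<mu> = {f \<in> borel_measurable \<mu>. integrable \<mu> (\<lambda>x. (cmod (f x))\<^sup>2)}"

definition L2_inner :: "'b measure \<Rightarrow> ('b \<Rightarrow> complex) \<Rightarrow> ('b \<Rightarrow> complex) \<Rightarrow> complex" where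
  "L2_inner \<mu> f g = (\<integral>x. f x * cnj (g x) \<partial>\<mu>)"

definition L2_norm :: "'b measure \<Rightarrow> ('b \<Rightarrow> complex) \<Rightarrow> real" where
  "L2_norm \<mu> f = sqrt (\<integral>x. (cmod (f x))\<^sup>2 \<partial>\<mu>)"

definition orthonormal_basis_L2 :: "'b measure \<Rightarrow> ('b \<Rightarrow> complex) set \<Rightarrow> bool" where
  "orthonormal_basis_L2 \<mu> B \<longleftrightarrow> B \<subseteq> L2 \<mu> \<and>
     (\<forall>\<phi>\<in>B. \<forall>\<psi>\<in>B. L2_inner \<mu> \<phi> \<psi> = (if \<phi> = \<psi> then 1 else 0)) \<and>
     (\<forall>f\<in>L2 \<mu>. \<forall>\<epsilon>>0. \<exists>F c. finite F \<and> F \<subseteq> B \<and>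
        L2_norm \<mu> (\<lambda>x. f x - (\<Sum>\<phi>\<in>F. c \<phi> * \<phi> x)) < \<epsilon>)"

definition shift_eigenfunction ::
    "(int \<Rightarrow> 'a) measure \<Rightarrow> ((int \<Rightarrow> 'a) \<Rightarrow> complex) \<Rightarrow> bool" where
  "shift_eigenfunction \<mu> \<phi> \<longleftrightarrow> (\<exists>c::complex. AE x in \<mu>. \<phi> (left_shift x) = c * \<phi> x)"

definition discrete_spectrum :: "(int \<Rightarrow> 'a) measure \<Rightarrow> bool" where
  "discrete_spectrum \<mu> \<longleftrightarrow>
     (\<exists>B. orthonormal_basis_L2 \<mu> B \<and> (\<forall>\<phi>\<in>B. shift_eigenfunction \<mu> \<phi>))"

section \<open>Amorphic complexity\<close>

definition induces_product_topology ::
    "((int \<Rightarrow> 'a::{finite, discrete_topology}) \<Rightarrow> (int \<Rightarrow> 'a) \<Rightarrow> real) \<Rightarrow> bool" where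
  "induces_product_topology d \<longleftrightarrow>
     Metric_space UNIV d \<and> Metric_space.mtopology UNIV d = euclidean"

definition sep_density ::
    "((int \<Rightarrow> 'a) \<Rightarrow> (int \<Rightarrow> 'a) \<Rightarrow> real) \<Rightarrow> real \<Rightarrow> (int \<Rightarrow> 'a) \<Rightarrow> (int \<Rightarrow> 'a) \<Rightarrow> ereal" where
  "sep_density d \<delta> x y = limsup (\<lambda>n. ereal
     (real (card {k. k < n \<and> d ((left_shift ^^ k) x) ((left_shift ^^ k) y) \<ge> \<delta>}) / real n))"

definition ext_card :: "'b set \<Rightarrow> ereal" where
  "ext_card Y = (if finite Y then ereal (real (card Y)) else \<infinity>)"

definition sep_number ::
    "((int \<Rightarrow> 'a) \<Rightarrow> (int \<Rightarrow> 'a) \<Rightarrow> real) \<Rightarrow> (int \<Rightarrow> 'a) set \<Rightarrow> real \<Rightarrow> real \<Rightarrow> ereal" where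
  "sep_number d X \<delta> \<nu> =
     (SUP Y \<in> {Y. Y \<subseteq> X \<and> (\<forall>x\<in>Y. \<forall>y\<in>Y. x \<noteq> y \<longrightarrow> sep_density d \<delta> x y \<ge> ereal \<nu>)}. ext_card Y)"

text \<open>Only used for arguments in \<open>[1, \<infinity>]\<close>: singletons give \<open>sep_number d X \<delta> \<nu> \<ge> 1\<close> if
  \<open>X \<noteq> {}\<close>.\<close>

definition log_ext :: "ereal \<Rightarrow> ereal" where
  "log_ext s = (if s = \<infinity> then \<infinity> else ereal (ln (real_of_ereal s)))"

definition lower_ac ::
    "((int \<Rightarrow> 'a) \<Rightarrow> (int \<Rightarrow> 'a) \<Rightarrow> real) \<Rightarrow> (int \<Rightarrow> 'a) set \<Rightarrow> ereal" where
  "lower_ac d X = (SUP \<delta>\<in>{0<..}.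
     Liminf (at_right 0) (\<lambda>\<nu>. log_ext (sep_number d X \<delta> \<nu>) / ereal (- ln \<nu>)))"

definition upper_ac ::
    "((int \<Rightarrow> 'a) \<Rightarrow> (int \<Rightarrow> 'a) \<Rightarrow> real) \<Rightarrow> (int \<Rightarrow> 'a) set \<Rightarrow> ereal" where
  "upper_ac d X = (SUP \<delta>\<in>{0<..}.
     Limsup (at_right 0) (\<lambda>\<nu>. log_ext (sep_number d X \<delta> \<nu>) / ereal (- ln \<nu>)))"

end

theory Submission
  imports Defs
begin

text \<open>
  Write \<open>q\<close> for a power of the length of the substitution such that the generating point \<open>x\<close> is
  fixed by the corresponding power. Then \<open>x\<close> splits, for every \<open>n\<close>, into blocks of length \<open>q\<^sup>n\<close>,
  the \<open>t\<close>-th one being the \<open>n\<close>-th image of the letter \<open>x t\<close>. Call two letters asymptotic if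
  the proportion of positions at which their \<open>n\<close>-th images differ tends to zero. Images of asymptotic
  letters are asymptotic position by position, so this proportion even decays exponentially in \<open>n\<close>,
  uniformly over all asymptotic pairs (\<open>asymptotic_rate_halves\<close>); for the other pairs it is
  bounded away from zero (\<open>not_asymptotic_rate_bound\<close>).

  Discrete spectrum enters only through the following claim: if \<open>x i0 = x (i0 + m)\<close> for some
  \<open>i0\<close>, then \<open>x i\<close> and \<open>x (i + m)\<close> are asymptotic for all \<open>i\<close>
  (\<open>discrete_spectrum_imp_asymptotic_period\<close>). Suppose this fails. Positions with
  \<open>x t = x (t + m)\<close> and positions where the two letters are not asymptotic both recur with bounded
  gaps. A position of the first kind gives a block of length \<open>q\<^sup>n\<close> on which \<open>x\<close> agrees with its
  translate by \<open>m q\<^sup>n\<close>. Inside this block, a fixed proportion of letters is not asymptotic to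
  the letters of the translate by \<open>m\<close>. Hence the translates of \<open>x\<close> by \<open>m\<close> and by \<open>m q\<^sup>n\<close> differ
  with a frequency bounded below independently of \<open>n\<close>, for all large \<open>n\<close>, and the same holds for \<open>m q\<^sup>r\<close> and
  \<open>m q\<^sup>n\<^sup>+\<^sup>r\<close>, because the pairs found are not asymptotic (\<open>mismatch_density\<close>). With discrete
  spectrum, on the other hand, any sequence of translates of the coordinate function is
  precompact in \<open>L\<^sub>2\<close>, so that two of the translates by \<open>m, m q\<^sup>e, m q\<^sup>2\<^sup>e, \<dots>\<close> are arbitrarily close
  (\<open>discrete_spectrum_almost_periodic\<close>). This is a contradiction.

  For the upper bound, every point of the orbit closure has a phase modulo \<open>m q\<^sup>n\<close>. Two points of the
  same phase are cut into blocks at the same places, and the letters behind corresponding blocks are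
  asymptotic by the claim. So the points differ with exponentially small frequency, and
  \<open>\<nu>\<close>-separated sets have at most \<open>m q\<^sup>n\<close> elements, where \<open>n\<close> is of the order of \<open>- ln \<nu>\<close>
  (\<open>sep_number_le\<close>).

  The lower bound comes from linear recurrence: since \<open>x\<close> is not periodic, the mismatches between
  \<open>x\<close> and its translate by \<open>k\<close> have gaps of at most \<open>C k\<close> with \<open>C\<close> independent of \<open>k\<close>
  (\<open>mismatch_gap\<close>). So the translates of \<open>x\<close> by \<open>0, \<dots>, M\<close> are pairwise separated
  with frequency \<open>1 / (C M)\<close>, and \<open>\<nu>\<close>-separated sets with about \<open>1 / (C \<nu>)\<close> elements exist
  (\<open>sep_number_ge\<close>).
\<close>

section \<open>Sequences over a finite alphabet\<close>

lemma compact_UNIV_sequences: "compact (UNIV :: (int \<Rightarrow> 'a::{finite, discrete_topology}) set)"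
proof -
  have "compact_space (product_topology (\<lambda>i::int. (euclidean :: 'a topology)) UNIV)"
    by (intro compact_space_product_topology[THEN iffD2] disjI2)
      (auto simp: compact_space_def compactin_euclidean_iff intro: finite_imp_compact)
  then show ?thesis
    by (simp add: euclidean_product_topology compact_space_def compactin_euclidean_iff)
qed

lemma open_coordinate: "open {y :: int \<Rightarrow> 'a::{finite, discrete_topology}. P (y i)}"
proof -
  have "open ((\<lambda>y :: int \<Rightarrow> 'a. y i) -` Collect P)"
    by (rule open_vimage[OF discrete_topology_class.open_discrete continuous_on_product_coordinates])
  then show ?thesis by (simp add: vimage_def)
qed

lemma open_cylinder:
  assumes "finite J"
  shows "open {y :: int \<Rightarrow> 'a::{finite, discrete_topology}. \<forall>j\<in>J. y j = w j}"
proof -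
  have "open (\<Inter>j\<in>J. {y :: int \<Rightarrow> 'a. y j = w j})"
    using assms by (intro open_INT ballI open_coordinate) auto
  then show ?thesis
    by (simp add: Collect_ball_eq)
qed

lemma open_contains_cylinder:
  fixes x :: "int \<Rightarrow> 'a::{finite, discrete_topology}"
  assumes "open U" "x \<in> U"
  obtains M :: nat where "\<And>y. (\<And>i. \<bar>i\<bar> \<le> int M \<Longrightarrow> y i = x i) \<Longrightarrow> y \<in> U"
proof -
  have "openin (product_topology (\<lambda>i::int. (euclidean :: 'a topology)) UNIV) U"
    using assms(1) by (simp add: euclidean_product_topology)
  from product_topology_open_contains_basis[OF this assms(2)] obtain V where
    V: "x \<in> (\<Pi>\<^sub>E i\<in>UNIV. V i)" "finite {i. V i \<noteq> UNIV}" "(\<Pi>\<^sub>E i\<in>UNIV. V i) \<subseteq> U"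
    by auto
  obtain B where B: "\<And>i. i \<in> {i. V i \<noteq> UNIV} \<Longrightarrow> \<bar>i\<bar> \<le> B"
    using V(2) finite_nat_set_iff_bounded_le[of "(\<lambda>i. nat \<bar>i\<bar>) ` {i. V i \<noteq> UNIV}"]
    by (metis (mono_tags, lifting) abs_ge_zero finite_imageI image_eqI nat_le_iff)
  show ?thesis
  proof (rule that[of "nat B"])
    fix y assume y: "\<And>i. \<bar>i\<bar> \<le> int (nat B) \<Longrightarrow> y i = x i"
    have "y i \<in> V i" for i
    proof (cases "V i = UNIV")
      case False
      then have "\<bar>i\<bar> \<le> int (nat B)" using B[of i] by auto
      then show ?thesis using y V(1) by (auto simp: PiE_iff)
    qed auto
    then show "y \<in> U" using V(3) by (auto simp: PiE_iff)
  qed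
qed

lemma orbit_subset_orbit_closure: "(\<lambda>n. x (n + k)) \<in> orbit_closure x"
  unfolding orbit_closure_def by (rule subsetD[OF closure_subset]) auto

lemma orbit_closure_window:
  assumes "y \<in> orbit_closure x"
  obtains k where "\<And>i. \<bar>i\<bar> \<le> int M \<Longrightarrow> y i = x (i + k)"
proof -
  let ?U = "{z. \<forall>i\<in>{- int M..int M}. z i = y i}"
  have "?U \<inter> range (\<lambda>k n. x (n + k)) \<noteq> {}"
    using assms open_Int_closure_eq_empty[of ?U "range (\<lambda>k n. x (n + k))"]
    unfolding orbit_closure_def by (auto intro: open_cylinder)
  then obtain k where "\<forall>i\<in>{- int M..int M}. x (i + k) = y i" by auto
  then show ?thesis by (intro that[of k]) (auto simp: abs_le_iff)
qed

lemma left_shift_funpow: "(left_shift ^^ k) x = (\<lambda>n. x (n + int k))"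
  by (induction k arbitrary: x)
    (auto simp: left_shift_def algebra_simps funpow_Suc_right simp del: funpow.simps(2))

text \<open>A word that never disappears from a minimal system reappears within bounded time: the
  points of \<open>X\<close> avoiding it would form a proper subsystem, so its occurrences at the various
  positions cover \<open>X\<close>, and finitely many positions are enough.\<close>

lemma minimal_uniformly_recurrent:
  fixes x :: "int \<Rightarrow> 'a::{finite, discrete_topology}"
  assumes "is_minimal_subshift (orbit_closure x)"
  shows "\<exists>R>0. \<forall>s. \<exists>t. s \<le> t \<and> t < s + int R \<and> (\<forall>j. 0 \<le> j \<and> j \<le> L \<longrightarrow> x (t + j) = x (i0 + j))"
proof -
  let ?X = "orbit_closure x"
  define U where "U i = {y. \<forall>j\<in>{i..i + L}. y j = x (j - i + i0)}" for i
  have opU: "open (U i)" for i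
    unfolding U_def by (rule open_cylinder) simp
  have clX: "closed ?X" and shX: "left_shift ` ?X = ?X"
    using assms by (auto simp: is_minimal_subshift_def is_subshift_def)
  have U_shift: "left_shift y \<in> U i \<longleftrightarrow> y \<in> U (i + 1)" for y i
  proof
    assume *: "left_shift y \<in> U i"
    show "y \<in> U (i + 1)" unfolding U_def
    proof (intro CollectI ballI)
      fix j assume "j \<in> {i + 1..i + 1 + L}"
      then show "y j = x (j - (i + 1) + i0)"
        using * by (auto simp: U_def left_shift_def dest!: bspec[of _ _ "j - 1"] simp: algebra_simps)
    qed
  next
    assume *: "y \<in> U (i + 1)"
    show "left_shift y \<in> U i" unfolding U_def
    proof (intro CollectI ballI)
      fix j assume "j \<in> {i..i + L}"
      then show "left_shift y j = x (j - i + i0)"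
        using * by (auto simp: U_def left_shift_def dest!: bspec[of _ _ "j + 1"] simp: algebra_simps)
    qed
  qed
  define E where "E = ?X - (\<Union>i. U i)"
  have "closed E"
    unfolding E_def by (intro closed_Diff clX open_UN ballI opU)
  moreover have "left_shift ` E = E"
  proof
    show "left_shift ` E \<subseteq> E"
      using shX by (auto simp: E_def U_shift)
    show "E \<subseteq> left_shift ` E"
    proof
      fix y assume y: "y \<in> E"
      then obtain z where z: "z \<in> ?X" "y = left_shift z"
        using shX by (auto simp: E_def)
      have "z \<notin> U i" for i
        using y z U_shift[of z "i - 1"] by (auto simp: E_def)
      then show "y \<in> left_shift ` E" using z by (auto simp: E_def)
    qed
  qed
  moreover have "E \<subset> ?X"
  proof -
    have "x \<in> U i0" by (auto simp: U_def)
    moreover have "x \<in> ?X" using orbit_subset_orbit_closure[of x 0] by simp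
    ultimately show ?thesis by (auto simp: E_def)
  qed
  ultimately have "E = {}"
    using assms by (auto simp: is_minimal_subshift_def)
  then have cover: "?X \<subseteq> (\<Union>i\<in>UNIV. U i)" by (auto simp: E_def)
  have "compact ?X"
    using compact_Int_closed[OF compact_UNIV_sequences clX] by simp
  from compactE_image[OF this opU cover] obtain I where I: "finite I" "?X \<subseteq> (\<Union>i\<in>I. U i)"
    by metis
  obtain B where B: "\<And>i. i \<in> I \<Longrightarrow> \<bar>i\<bar> < int B"
  proof -
    have "finite ((\<lambda>i. nat \<bar>i\<bar>) ` I)" using I by simp
    then obtain B where "\<forall>k\<in>(\<lambda>i. nat \<bar>i\<bar>) ` I. k < B"
      using finite_nat_set_iff_bounded by auto
    then show ?thesis by (intro that[of B]) auto
  qed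
  show ?thesis
  proof (intro exI[of _ "2 * B + 1"] conjI allI)
    fix s
    have "(\<lambda>n. x (n + (s + int B))) \<in> ?X" by (rule orbit_subset_orbit_closure)
    then obtain i where i: "i \<in> I" "(\<lambda>n. x (n + (s + int B))) \<in> U i" using I by blast
    have "x (i + s + int B + j) = x (i0 + j)" if "0 \<le> j" "j \<le> L" for j
      using i(2) that by (auto simp: U_def algebra_simps dest!: bspec[of _ _ "i + j"])
    then show "\<exists>t. s \<le> t \<and> t < s + int (2 * B + 1) \<and> (\<forall>j. 0 \<le> j \<and> j \<le> L \<longrightarrow> x (t + j) = x (i0 + j))"
      using B[OF i(1)] by (intro exI[of _ "i + s + int B"]) auto
  qed simp
qed

text \<open>By compactness, any metric for the product topology is uniformly comparable with agreement
  on windows around the origin.\<close>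

lemma metric_small_if_agree_on_window:
  fixes d :: "(int \<Rightarrow> 'a::{finite, discrete_topology}) \<Rightarrow> (int \<Rightarrow> 'a) \<Rightarrow> real"
  assumes d: "induces_product_topology d" and "\<delta> > 0"
  shows "\<exists>W :: nat. \<forall>x y. (\<forall>i. \<bar>i\<bar> \<le> int W \<longrightarrow> x i = y i) \<longrightarrow> d x y < \<delta>"
proof -
  interpret Metric_space UNIV d using d by (simp add: induces_product_topology_def)
  have opn: "open (mball z r)" for z r
    using d openin_mball[of z r] by (simp add: induces_product_topology_def)
  have "\<exists>M::nat. \<forall>y. (\<forall>i. \<bar>i\<bar> \<le> int M \<longrightarrow> y i = z i) \<longrightarrow> y \<in> mball z (\<delta> / 2)" for z
  proof -
    have "z \<in> mball z (\<delta> / 2)" using \<open>\<delta> > 0\<close> by simp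
    from open_contains_cylinder[OF opn this] show ?thesis by metis
  qed
  then obtain M :: "_ \<Rightarrow> nat" where
    M: "\<And>z y. (\<And>i. \<bar>i\<bar> \<le> int (M z) \<Longrightarrow> y i = z i) \<Longrightarrow> y \<in> mball z (\<delta> / 2)"
    by metis
  define C where "C z = {y. \<forall>i\<in>{- int (M z)..int (M z)}. y i = z i}" for z
  have "open (C z)" for z unfolding C_def by (rule open_cylinder) simp
  moreover have "UNIV \<subseteq> (\<Union>z\<in>UNIV. C z)" by (auto simp: C_def)
  ultimately obtain Z where Z: "finite Z" "UNIV \<subseteq> (\<Union>z\<in>Z. C z)"
    using compactE_image[OF compact_UNIV_sequences, of UNIV C] by metis
  define W where "W = Max (insert 0 (M ` Z))"
  have W: "M z \<le> W" if "z \<in> Z" for z using that Z(1) by (auto simp: W_def)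
  show ?thesis
  proof (intro exI[of _ W] allI impI)
    fix x y :: "int \<Rightarrow> 'a" assume xy: "\<forall>i. \<bar>i\<bar> \<le> int W \<longrightarrow> x i = y i"
    obtain z where z: "z \<in> Z" "x \<in> C z" using Z(2) by blast
    have *: "x i = z i \<and> y i = z i" if "\<bar>i\<bar> \<le> int (M z)" for i
      using that z xy W[OF z(1)] by (force simp: C_def abs_le_iff)
    have "x \<in> mball z (\<delta> / 2)" "y \<in> mball z (\<delta> / 2)" by (rule M, simp add: *)+
    then have "d z x < \<delta> / 2" "d z y < \<delta> / 2" by auto
    then show "d x y < \<delta>" using triangle[of x z y] commute[of x z] by simp
  qed
qed

lemma agree_at_origin_if_metric_small:
  fixes d :: "(int \<Rightarrow> 'a::{finite, discrete_topology}) \<Rightarrow> (int \<Rightarrow> 'a) \<Rightarrow> real"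
  assumes d: "induces_product_topology d"
  obtains \<delta> where "\<delta> > 0" "\<And>x y. d x y < \<delta> \<Longrightarrow> x 0 = y 0"
proof -
  interpret Metric_space UNIV d using d by (simp add: induces_product_topology_def)
  have top: "mtopology = euclidean" using d by (simp add: induces_product_topology_def)
  have opn: "open (mball z r)" for z r
    using top openin_mball[of z r] by simp
  have "\<exists>r>0. mball z (2 * r) \<subseteq> {y. y 0 = z 0}" for z
  proof -
    have "openin mtopology {y. y 0 = z 0}" using open_coordinate top by simp
    then obtain r where "r > 0" "mball z r \<subseteq> {y. y 0 = z 0}"
      unfolding openin_mtopology by blast
    then show ?thesis by (intro exI[of _ "r / 2"]) auto
  qed
  then obtain r where r: "\<And>z. r z > 0" "\<And>z. mball z (2 * r z) \<subseteq> {y. y 0 = z 0}"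
    by metis
  have "UNIV \<subseteq> (\<Union>z\<in>UNIV. mball z (r z))" using r(1) by fastforce
  then obtain Z where Z: "finite Z" "UNIV \<subseteq> (\<Union>z\<in>Z. mball z (r z))"
    using compactE_image[OF compact_UNIV_sequences, of UNIV "\<lambda>z. mball z (r z)"] opn by metis
  define \<delta> where "\<delta> = Min (insert 1 (r ` Z))"
  have \<delta>: "\<delta> \<le> r z" if "z \<in> Z" for z using that Z(1) by (auto simp: \<delta>_def)
  show ?thesis
  proof (rule that[of \<delta>])
    show "\<delta> > 0" using Z(1) r(1) by (auto simp: \<delta>_def)
    fix x y :: "int \<Rightarrow> 'a" assume xy: "d x y < \<delta>"
    obtain z where z: "z \<in> Z" "x \<in> mball z (r z)" using Z(2) by blast
    have "d z x < r z" "d z y \<le> d z x + d x y"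
      using z triangle[of z x y] by auto
    then have "x \<in> mball z (2 * r z)" "y \<in> mball z (2 * r z)"
      using xy \<delta>[OF z(1)] r(1)[of z] by auto
    then have "x \<in> {y. y 0 = z 0}" "y \<in> {y. y 0 = z 0}" using r(2)[of z] by blast+
    then show "x 0 = y 0" by simp
  qed
qed

section \<open>Almost periodicity from discrete spectrum\<close>

lemma common_convergent_subsequence:
  fixes u :: "'b \<Rightarrow> nat \<Rightarrow> complex"
  assumes "finite F" "\<And>\<phi>. \<phi> \<in> F \<Longrightarrow> bounded (range (u \<phi>))"
  shows "\<exists>r. strict_mono (r :: nat \<Rightarrow> nat) \<and> (\<forall>\<phi>\<in>F. convergent (u \<phi> \<circ> r))"
  using assms
proof (induction F rule: finite_induct)
  case empty
  show ?case by (intro exI[of _ id]) (auto simp: strict_mono_id)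
next
  case (insert \<phi> F)
  have "\<exists>r. strict_mono (r :: nat \<Rightarrow> nat) \<and> (\<forall>\<psi>\<in>F. convergent (u \<psi> \<circ> r))"
    by (intro insert.IH insert.prems insertI2)
  then obtain r :: "nat \<Rightarrow> nat" where r: "strict_mono r" "\<forall>\<psi>\<in>F. convergent (u \<psi> \<circ> r)"
    by blast
  have "bounded (range (u \<phi> \<circ> r))"
    using insert.prems[of \<phi>] by (rule bounded_subset) auto
  then obtain l s where s: "strict_mono s" "(u \<phi> \<circ> r \<circ> s) \<longlonglongrightarrow> l"
    using bounded_imp_convergent_subsequence by blast
  have "convergent (u \<psi> \<circ> (r \<circ> s))" if "\<psi> \<in> insert \<phi> F" for \<psi>
    using that s r convergent_subseq_convergent[of "u \<psi> \<circ> r" s]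
    by (auto simp: o_assoc convergentI)
  then show ?case
    using strict_mono_o[OF r(1) s(1)] by blast
qed

text \<open>The powers \<open>c \<phi> ^ k i\<close> stay in a compact set, so two of them, simultaneously for all \<open>\<phi>\<close>, are
  close to each other; as \<open>c \<phi>\<close> has modulus one, so are their quotient and one.\<close>

lemma unimodular_powers_recur:
  fixes c :: "'b \<Rightarrow> complex" and k :: "nat \<Rightarrow> nat"
  assumes "finite F" "\<And>\<phi>. \<phi> \<in> F \<Longrightarrow> cmod (c \<phi>) = 1" "mono k" "\<eta> > 0"
  shows "\<exists>i j. i < j \<and> (\<forall>\<phi>\<in>F. cmod (c \<phi> ^ (k j - k i) - 1) < \<eta>)"
proof -
  have "bounded (range (\<lambda>i. c \<phi> ^ k i))" if "\<phi> \<in> F" for \<phi>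
    using assms(2)[OF that] by (intro boundedI[of _ 1]) (auto simp: norm_power)
  from common_convergent_subsequence[OF assms(1), of "\<lambda>\<phi> i. c \<phi> ^ k i", OF this]
  obtain r :: "nat \<Rightarrow> nat" where
    r: "strict_mono r" "\<And>\<phi>. \<phi> \<in> F \<Longrightarrow> convergent (\<lambda>i. c \<phi> ^ k (r i))"
    by (auto simp: o_def)
  have "\<exists>N. \<forall>m\<ge>N. \<forall>n\<ge>N. cmod (c \<phi> ^ k (r m) - c \<phi> ^ k (r n)) < \<eta>" if "\<phi> \<in> F" for \<phi>
    using convergent_Cauchy[OF r(2)[OF that]] \<open>\<eta> > 0\<close> by (auto simp: Cauchy_def dist_norm)
  then obtain N :: "'b \<Rightarrow> nat" where
    N: "\<And>\<phi> m n. \<lbrakk>\<phi> \<in> F; m \<ge> N \<phi>; n \<ge> N \<phi>\<rbrakk> \<Longrightarrow> cmod (c \<phi> ^ k (r m) - c \<phi> ^ k (r n)) < \<eta>"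
    by metis
  define n where "n = Max (insert 0 (N ` F))"
  have n: "N \<phi> \<le> n" if "\<phi> \<in> F" for \<phi> using that assms(1) by (auto simp: n_def)
  have lt: "r n < r (Suc n)" using r(1) by (simp add: strict_mono_def)
  then have le: "k (r n) \<le> k (r (Suc n))" using \<open>mono k\<close> by (simp add: monoD)
  have "cmod (c \<phi> ^ (k (r (Suc n)) - k (r n)) - 1) < \<eta>" if "\<phi> \<in> F" for \<phi>
  proof -
    have "c \<phi> ^ k (r (Suc n)) - c \<phi> ^ k (r n) =
        c \<phi> ^ k (r n) * (c \<phi> ^ (k (r (Suc n)) - k (r n)) - 1)"
      using le by (simp add: algebra_simps flip: power_add)
    then have "cmod (c \<phi> ^ k (r (Suc n)) - c \<phi> ^ k (r n)) =
        cmod (c \<phi> ^ (k (r (Suc n)) - k (r n)) - 1)"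
      using assms(2)[OF that] by (simp add: norm_mult norm_power)
    then show ?thesis using N[OF that, of "Suc n" n] n[OF that] by simp
  qed
  then show ?thesis using lt by blast
qed

lemma cmod_add_squared_le: "(cmod (a + b))\<^sup>2 \<le> 2 * (cmod a)\<^sup>2 + 2 * (cmod b)\<^sup>2"
proof -
  have "(cmod (a + b))\<^sup>2 \<le> (cmod a + cmod b)\<^sup>2"
    by (intro power_mono norm_triangle_ineq) auto
  also have "\<dots> \<le> 2 * (cmod a)\<^sup>2 + 2 * (cmod b)\<^sup>2"
    using sum_squares_bound[of "cmod a" "cmod b"] by (simp add: power2_sum)
  finally show ?thesis .
qed

lemma L2_add:
  assumes "f \<in> L2 M" "g \<in> L2 M"
  shows "(\<lambda>x. f x + g x) \<in> L2 M"
proof -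
  have [measurable]: "f \<in> borel_measurable M" "g \<in> borel_measurable M"
    using assms by (auto simp: L2_def)
  have "integrable M (\<lambda>x. 2 * (cmod (f x))\<^sup>2 + 2 * (cmod (g x))\<^sup>2)"
    using assms by (auto simp: L2_def)
  then have "integrable M (\<lambda>x. (cmod (f x + g x))\<^sup>2)"
    by (rule Bochner_Integration.integrable_bound) (auto simp: cmod_add_squared_le)
  then show ?thesis by (simp add: L2_def)
qed

lemma L2_mult_left:
  assumes "f \<in> L2 M"
  shows "(\<lambda>x. a * f x) \<in> L2 M"
  using assms by (auto simp: L2_def norm_mult power_mult_distrib)

lemma L2_cmod:
  assumes "f \<in> L2 M"
  shows "(\<lambda>x. complex_of_real (cmod (f x))) \<in> L2 M"
  using assms by (auto simp: L2_def)

lemma L2_sum: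
  assumes "finite F" "\<And>\<phi>. \<phi> \<in> F \<Longrightarrow> f \<phi> \<in> L2 M"
  shows "(\<lambda>x. \<Sum>\<phi>\<in>F. f \<phi> x) \<in> L2 M"
  using assms
proof (induction F rule: finite_induct)
  case (insert \<phi> F)
  then have "(\<lambda>x. f \<phi> x + (\<Sum>\<phi>\<in>F. f \<phi> x)) \<in> L2 M" by (intro L2_add) auto
  then show ?case using insert.hyps by simp
qed (simp add: L2_def)

context
  fixes X :: "(int \<Rightarrow> 'a::{finite, discrete_topology}) set" and \<mu> :: "(int \<Rightarrow> 'a) measure"
  assumes inv: "invariant_prob X \<mu>"
begin

lemma coordinate_function_measurable: "(\<lambda>y. g (y i)) \<in> borel_measurable \<mu>"
  for g :: "'a \<Rightarrow> 'b::topological_space"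
proof -
  have "continuous_on UNIV (\<lambda>y :: int \<Rightarrow> 'a. g (y i))"
    by (simp add: continuous_on_open_vimage vimage_def open_coordinate[of "\<lambda>a. g a \<in> _"])
  then have "(\<lambda>y. g (y i)) \<in> borel_measurable (restrict_space borel X)"
    by (intro measurable_restrict_space1 borel_measurable_continuous_onI)
  moreover have "sets \<mu> = sets (restrict_space borel X)"
    using inv by (simp add: invariant_prob_def)
  ultimately show ?thesis
    using measurable_cong_sets by blast
qed

lemma shift_power_measure_preserving:
  "(left_shift ^^ k) \<in> measurable \<mu> \<mu> \<and> distr \<mu> \<mu> (left_shift ^^ k) = \<mu>"
proof (induction k)
  case 0
  then show ?case by (simp add: id_def distr_id2)
next
  case (Suc k)
  have s: "left_shift \<in> measurable \<mu> \<mu>" "distr \<mu> \<mu> left_shift = \<mu>"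
    using inv by (auto simp: invariant_prob_def)
  have "distr (distr \<mu> \<mu> (left_shift ^^ k)) \<mu> left_shift =
      distr \<mu> \<mu> (left_shift \<circ> (left_shift ^^ k))"
    using s Suc by (intro distr_distr) auto
  then have "distr \<mu> \<mu> (left_shift ^^ Suc k) = \<mu>" using s(2) Suc by (simp only: funpow.simps)
  moreover have "(left_shift ^^ Suc k) \<in> measurable \<mu> \<mu>"
    using measurable_comp[of "left_shift ^^ k" \<mu> \<mu> left_shift \<mu>] s(1) Suc
    by (simp only: funpow.simps)
  ultimately show ?case by blast
qed

lemmas shift_power_measurable [measurable] = shift_power_measure_preserving[THEN conjunct1]

lemma integral_shift_power:
  fixes f :: "(int \<Rightarrow> 'a) \<Rightarrow> real"
  assumes "f \<in> borel_measurable \<mu>"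
  shows "(\<integral>y. f ((left_shift ^^ k) y) \<partial>\<mu>) = (\<integral>y. f y \<partial>\<mu>)"
    and "integrable \<mu> (\<lambda>y. f ((left_shift ^^ k) y)) \<longleftrightarrow> integrable \<mu> f"
  using integral_distr[of "left_shift ^^ k" \<mu> \<mu> f] integrable_distr_eq[of "left_shift ^^ k" \<mu> \<mu> f]
    shift_power_measure_preserving[of k] assms by auto

lemma eigenfunction_shift_power:
  fixes \<phi> :: "(int \<Rightarrow> 'a) \<Rightarrow> complex"
  assumes "AE y in \<mu>. \<phi> (left_shift y) = c * \<phi> y"
  shows "AE y in \<mu>. \<phi> ((left_shift ^^ k) y) = c ^ k * \<phi> y"
proof (induction k)
  case (Suc k)
  have "AE y in distr \<mu> \<mu> (left_shift ^^ k). \<phi> (left_shift y) = c * \<phi> y"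
    using assms by (subst shift_power_measure_preserving[THEN conjunct2])
  from AE_distrD[OF shift_power_measurable this] Suc
  show ?case by eventually_elim (simp add: mult.assoc)
qed simp

text \<open>The shift preserves the norm of \<open>\<phi>\<close>, which is not zero.\<close>

lemma eigenvalue_unimodular:
  assumes \<phi>: "\<phi> \<in> L2 \<mu>" "L2_inner \<mu> \<phi> \<phi> = 1"
    and "AE y in \<mu>. \<phi> (left_shift y) = c * \<phi> y"
  shows "cmod c = 1"
proof -
  have [measurable]: "\<phi> \<in> borel_measurable \<mu>" using \<phi> by (simp add: L2_def)
  have "complex_of_real (\<integral>y. (cmod (\<phi> y))\<^sup>2 \<partial>\<mu>) = 1"
    using \<phi>(2) by (simp only: L2_inner_def flip: complex_norm_square integral_complex_of_real)
  then have 1: "(\<integral>y. (cmod (\<phi> y))\<^sup>2 \<partial>\<mu>) = 1" by simp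
  have "(\<integral>y. (cmod (\<phi> y))\<^sup>2 \<partial>\<mu>) = (\<integral>y. (cmod (\<phi> ((left_shift ^^ 1) y)))\<^sup>2 \<partial>\<mu>)"
    by (rule integral_shift_power(1)[symmetric]) measurable
  also have "\<dots> = (\<integral>y. (cmod c)\<^sup>2 * (cmod (\<phi> y))\<^sup>2 \<partial>\<mu>)"
  proof (rule integral_cong_AE)
    show "AE y in \<mu>. (cmod (\<phi> ((left_shift ^^ 1) y)))\<^sup>2 = (cmod c)\<^sup>2 * (cmod (\<phi> y))\<^sup>2"
      using assms(3) by eventually_elim (simp add: norm_mult power_mult_distrib)
  qed measurable
  finally have "(cmod c)\<^sup>2 = 1" using 1 by simp
  then show ?thesis by (simp add: power2_eq_1_iff) (use norm_ge_zero[of c] in linarith)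
qed

text \<open>Approximate the coordinate at the origin in \<open>L\<^sub>2\<close> by a finite combination of eigenfunctions.
  A power of the shift whose eigenvalues on these functions are all close to one moves the
  combination, hence also the coordinate, very little; differences of any sequence of exponents
  contain such powers.\<close>

lemma discrete_spectrum_almost_periodic:
  fixes k :: "nat \<Rightarrow> nat"
  assumes "discrete_spectrum \<mu>" "mono k" "\<epsilon> > 0"
  shows "\<exists>i j. i < j \<and> measure \<mu> {y \<in> space \<mu>. y 0 \<noteq> y (int (k j - k i))} < \<epsilon>"
proof -
  interpret prob_space \<mu> using inv by (simp add: invariant_prob_def)
  obtain B where B: "orthonormal_basis_L2 \<mu> B" "\<forall>\<phi>\<in>B. shift_eigenfunction \<mu> \<phi>"
    using assms(1) by (auto simp: discrete_spectrum_def)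
  obtain code :: "'a \<Rightarrow> nat" where code: "inj code"
    using finite_imp_inj_to_nat_seg[of "UNIV :: 'a set"] by auto
  \<comment> \<open>Distinct letters have codes at distance at least one, so \<open>f\<close> detects every change of the
    coordinate at the origin by an amount of at least one.\<close>
  define f :: "(int \<Rightarrow> 'a) \<Rightarrow> complex" where "f y = of_nat (code (y 0))" for y
  have fm [measurable]: "f \<in> borel_measurable \<mu>"
    unfolding f_def by (rule coordinate_function_measurable)
  have "integrable \<mu> (\<lambda>y. (cmod (f y))\<^sup>2)"
  proof (rule integrable_const_bound[where B = "real (\<Sum>a\<in>UNIV. (code a)\<^sup>2)"])
    have "(code a)\<^sup>2 \<le> (\<Sum>a\<in>UNIV. (code a)\<^sup>2)" for a by (rule member_le_sum) auto
    from of_nat_mono[OF this, where 'a = real]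
    have "(real (code a))\<^sup>2 \<le> real (\<Sum>a\<in>UNIV. (code a)\<^sup>2)" for a
      by (simp only: of_nat_power)
    then show "AE y in \<mu>. norm ((cmod (f y))\<^sup>2) \<le> real (\<Sum>a\<in>UNIV. (code a)\<^sup>2)"
      unfolding f_def norm_of_nat real_norm_def abs_power2 by (intro AE_I2)
  qed measurable
  then have f: "f \<in> L2 \<mu>" by (simp add: L2_def)
  \<comment> \<open>The final estimate is \<open>8 e\<^sup>2 + 2 \<eta>\<^sup>2 I\<close>, where \<open>I\<close> is the integral of \<open>G\<^sup>2\<close>; here \<open>8 e\<^sup>2\<close> gets
    two thirds of \<open>\<epsilon>\<close>, and \<open>\<eta>\<close> is chosen below so that the other term gets at most one third.\<close>
  define e where "e = sqrt (\<epsilon> / 12)"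
  have e: "e > 0" "e\<^sup>2 = \<epsilon> / 12" using \<open>\<epsilon> > 0\<close> by (auto simp: e_def)
  obtain F a where F: "finite F" "F \<subseteq> B" "L2_norm \<mu> (\<lambda>y. f y - (\<Sum>\<phi>\<in>F. a \<phi> * \<phi> y)) < e"
    using B(1)[unfolded orthonormal_basis_L2_def, THEN conjunct2, THEN conjunct2, rule_format, OF f e(1)]
    by blast
  have FL: "\<phi> \<in> L2 \<mu>" if "\<phi> \<in> F" for \<phi>
    using that F(2) B(1) by (auto simp: orthonormal_basis_L2_def)
  define g where "g y = (\<Sum>\<phi>\<in>F. a \<phi> * \<phi> y)" for y
  have gL: "g \<in> L2 \<mu>"
    unfolding g_def by (intro L2_sum F(1) L2_mult_left FL)
  then have gm [measurable]: "g \<in> borel_measurable \<mu>" by (simp add: L2_def)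
  define r where "r y = (cmod (f y - g y))\<^sup>2" for y
  have rm [measurable]: "r \<in> borel_measurable \<mu>" unfolding r_def by measurable
  have ri: "integrable \<mu> r"
    using L2_add[OF f L2_mult_left[OF gL, of "-1"]] by (simp add: L2_def r_def[abs_def])
  have r: "(\<integral>y. r y \<partial>\<mu>) < \<epsilon> / 12"
  proof -
    have "sqrt (\<integral>y. r y \<partial>\<mu>) < sqrt (\<epsilon> / 12)"
      using F(3) by (simp add: L2_norm_def g_def r_def e_def)
    then show ?thesis by (rule real_sqrt_less_iff[THEN iffD1])
  qed
  define G where "G y = (\<Sum>\<phi>\<in>F. cmod (a \<phi> * \<phi> y))" for y
  have GL: "(\<lambda>y. complex_of_real (G y)) \<in> L2 \<mu>"
    unfolding G_def of_real_sum by (intro L2_sum F(1) L2_cmod L2_mult_left FL)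
  then have Gi: "integrable \<mu> (\<lambda>y. (G y)\<^sup>2)"
    by (simp add: L2_def)
  have G0: "0 \<le> G y" for y unfolding G_def by (intro sum_nonneg) auto
  define I where "I = (\<integral>y. (G y)\<^sup>2 \<partial>\<mu>)"
  have I: "0 \<le> I" unfolding I_def by (intro integral_nonneg_AE) auto
  define \<eta> where "\<eta> = sqrt (\<epsilon> / (6 * (I + 1)))"
  have \<eta>: "\<eta> > 0" "\<eta>\<^sup>2 = \<epsilon> / (6 * (I + 1))" using \<open>\<epsilon> > 0\<close> I by (auto simp: \<eta>_def)
  have "\<exists>c. AE y in \<mu>. \<phi> (left_shift y) = c * \<phi> y" if "\<phi> \<in> F" for \<phi>
    using that F(2) B(2) by (auto simp: shift_eigenfunction_def)
  then obtain c where c: "\<And>\<phi>. \<phi> \<in> F \<Longrightarrow> AE y in \<mu>. \<phi> (left_shift y) = c \<phi> * \<phi> y"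
    by metis
  have c1: "cmod (c \<phi>) = 1" if "\<phi> \<in> F" for \<phi>
    using eigenvalue_unimodular[OF FL[OF that] _ c[OF that]] that F(2) B(1)
    by (auto simp: orthonormal_basis_L2_def)
  obtain i j where ij: "i < j" "\<forall>\<phi>\<in>F. cmod (c \<phi> ^ (k j - k i) - 1) < \<eta>"
    using unimodular_powers_recur[of F c k \<eta>] F(1) c1 \<open>mono k\<close> \<eta>(1) by metis
  define K where "K = k j - k i"
  let ?S = "left_shift ^^ K"
  have "AE y in \<mu>. \<forall>\<phi>\<in>F. \<phi> (?S y) = c \<phi> ^ K * \<phi> y"
    by (intro AE_finite_allI F(1) eigenfunction_shift_power c)
  then have "AE y in \<mu>. indicator {y. y 0 \<noteq> y (int K)} y \<le>
      4 * r (?S y) + 4 * r y + 2 * (\<eta>\<^sup>2 * (G y)\<^sup>2)"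
  proof eventually_elim
    case (elim y)
    have "cmod (g (?S y) - g y) \<le> (\<Sum>\<phi>\<in>F. cmod (a \<phi> * \<phi> (?S y) - a \<phi> * \<phi> y))"
      unfolding g_def sum_subtractf[symmetric] by (rule norm_sum)
    also have "\<dots> = (\<Sum>\<phi>\<in>F. cmod (c \<phi> ^ K - 1) * cmod (a \<phi> * \<phi> y))"
    proof (rule sum.cong)
      fix \<phi> assume "\<phi> \<in> F"
      then have "a \<phi> * \<phi> (?S y) - a \<phi> * \<phi> y = (c \<phi> ^ K - 1) * (a \<phi> * \<phi> y)"
        using elim by (simp add: algebra_simps)
      then show "cmod (a \<phi> * \<phi> (?S y) - a \<phi> * \<phi> y) = cmod (c \<phi> ^ K - 1) * cmod (a \<phi> * \<phi> y)"
        by (simp only: norm_mult)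
    qed simp
    also have "\<dots> \<le> (\<Sum>\<phi>\<in>F. \<eta> * cmod (a \<phi> * \<phi> y))"
      using ij(2) by (intro sum_mono mult_right_mono) (auto simp: K_def intro: less_imp_le)
    also have "\<dots> = \<eta> * G y" by (simp add: G_def sum_distrib_left)
    finally have "(cmod (g (?S y) - g y))\<^sup>2 \<le> (\<eta> * G y)\<^sup>2" by (rule power_mono) simp
    then have 1: "(cmod (g (?S y) - g y))\<^sup>2 \<le> \<eta>\<^sup>2 * (G y)\<^sup>2" by (simp add: power_mult_distrib)
    have "(cmod (f (?S y) - f y))\<^sup>2 \<le>
        2 * (cmod ((f (?S y) - g (?S y)) + (g y - f y)))\<^sup>2 + 2 * (cmod (g (?S y) - g y))\<^sup>2"
      using cmod_add_squared_le[of "(f (?S y) - g (?S y)) + (g y - f y)" "g (?S y) - g y"] by simp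
    also have "\<dots> \<le> 2 * (2 * r (?S y) + 2 * r y) + 2 * (cmod (g (?S y) - g y))\<^sup>2"
      using cmod_add_squared_le[of "f (?S y) - g (?S y)" "g y - f y"]
      by (simp add: r_def norm_minus_commute)
    finally have 2: "(cmod (f (?S y) - f y))\<^sup>2 \<le> 4 * r (?S y) + 4 * r y + 2 * (\<eta>\<^sup>2 * (G y)\<^sup>2)"
      using 1 by simp
    have "indicator {y. y 0 \<noteq> y (int K)} y \<le> (cmod (f (?S y) - f y))\<^sup>2"
    proof (cases "y 0 = y (int K)")
      case False
      then have "code (y 0) \<noteq> code (y (int K))" using code by (simp add: inj_eq)
      then have "1 \<le> \<bar>real (code (y (int K))) - real (code (y 0))\<bar>" by linarith
      then have "1\<^sup>2 \<le> \<bar>real (code (y (int K))) - real (code (y 0))\<bar>\<^sup>2" by (intro power_mono) auto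
      moreover have "f (?S y) - f y = complex_of_real (real (code (y (int K))) - real (code (y 0)))"
        by (simp add: f_def left_shift_funpow)
      then have "cmod (f (?S y) - f y) = \<bar>real (code (y (int K))) - real (code (y 0))\<bar>"
        by (simp only: norm_of_real)
      ultimately show ?thesis using False by (simp add: indicator_def)
    qed simp
    then show ?case using 2 by linarith
  qed
  moreover have Em: "{y \<in> space \<mu>. y 0 \<noteq> y (int K)} \<in> sets \<mu>"
  proof -
    have "{y \<in> space \<mu>. real (code (y 0)) \<noteq> real (code (y (int K)))} \<in> sets \<mu>"
      by (intro borel_measurable_neq coordinate_function_measurable)
    then show ?thesis using code by (simp add: inj_eq)
  qed
  ultimately have AE: "AE y in \<mu>. indicator {y \<in> space \<mu>. y 0 \<noteq> y (int K)} y \<le>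
      4 * r (?S y) + 4 * r y + 2 * (\<eta>\<^sup>2 * (G y)\<^sup>2)"
    using AE_space by (auto elim!: eventually_mono simp: indicator_def)
  have Ei: "integrable \<mu> (indicat_real {y \<in> space \<mu>. y 0 \<noteq> y (int K)})"
    using Em by (intro integrable_real_indicator) (auto simp: less_top[symmetric])
  have riS: "integrable \<mu> (\<lambda>y. r (?S y))" using integral_shift_power(2)[OF rm] ri by simp
  have "measure \<mu> {y \<in> space \<mu>. y 0 \<noteq> y (int K)} =
      (\<integral>y. indicator {y \<in> space \<mu>. y 0 \<noteq> y (int K)} y \<partial>\<mu>)"
    by (simp add: Int_absorb2 Collect_restrict)
  also have "\<dots> \<le> (\<integral>y. 4 * r (?S y) + 4 * r y + 2 * (\<eta>\<^sup>2 * (G y)\<^sup>2) \<partial>\<mu>)"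
    using riS ri Gi Ei AE by (intro integral_mono_AE) auto
  also have "\<dots> = 8 * (\<integral>y. r y \<partial>\<mu>) + 2 * (\<eta>\<^sup>2 * I)"
    using riS ri Gi integral_shift_power(1)[OF rm, of K] by (simp add: I_def)
  also have "\<dots> < 8 * (\<epsilon> / 12) + 2 * (\<epsilon> / 6)"
  proof -
    have "\<eta>\<^sup>2 * I \<le> \<epsilon> / 6" using I \<open>\<epsilon> > 0\<close> by (simp add: \<eta>(2) field_simps)
    then show ?thesis using r by linarith
  qed
  also have "\<dots> = \<epsilon>" by simp
  finally show ?thesis using ij(1) unfolding K_def by blast
qed

end

section \<open>Counting in blocks\<close>

lemma mod_mult_div_eq_div_mod:
  fixes i b c :: int
  assumes "b > 0" "c \<ge> 0"
  shows "(i mod (b * c)) div b = (i div b) mod c"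
  using assms by (simp add: zmod_zmult2_eq)

lemma block_div_mod:
  fixes Q :: int
  assumes "i \<in> {t * Q..<(t + 1) * Q}"
  shows "i div Q = t" "i mod Q = i - t * Q"
proof -
  have "0 \<le> i - t * Q" "i - t * Q < Q" using assms by (auto simp: algebra_simps)
  then have "(t * Q + (i - t * Q)) div Q = t" by (subst div_mult_self3) (auto simp: mult.commute)
  then show "i div Q = t" by simp
  then show "i mod Q = i - t * Q" by (simp add: minus_div_mult_eq_mod[symmetric])
qed

lemma card_block:
  fixes Q :: int
  assumes "Q > 0"
  shows "card ({i. P (i div Q) (i mod Q)} \<inter> {t * Q..<(t + 1) * Q}) = card {j \<in> {0..<Q}. P t j}"
proof -
  have "{i. P (i div Q) (i mod Q)} \<inter> {t * Q..<(t + 1) * Q} = (\<lambda>j. t * Q + j) ` {j \<in> {0..<Q}. P t j}"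
  proof (intro equalityI subsetI)
    fix i assume i: "i \<in> {i. P (i div Q) (i mod Q)} \<inter> {t * Q..<(t + 1) * Q}"
    then have "P t (i - t * Q)" using block_div_mod[of i t Q] by auto
    then show "i \<in> (\<lambda>j. t * Q + j) ` {j \<in> {0..<Q}. P t j}"
      using i by (intro image_eqI[of _ _ "i - t * Q"]) (auto simp: algebra_simps)
  next
    fix i assume "i \<in> (\<lambda>j. t * Q + j) ` {j \<in> {0..<Q}. P t j}"
    then obtain j where j: "i = t * Q + j" "0 \<le> j" "j < Q" "P t j" by auto
    then have "i \<in> {t * Q..<(t + 1) * Q}" by (simp add: algebra_simps)
    then show "i \<in> {i. P (i div Q) (i mod Q)} \<inter> {t * Q..<(t + 1) * Q}"
      using j block_div_mod[of i t Q] by auto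
  qed
  then show ?thesis by (simp add: card_image inj_on_def)
qed

lemma card_blocks:
  fixes Q :: int
  assumes "Q > 0"
  shows "card (S \<inter> {a * Q..<b * Q}) = (\<Sum>t\<in>{a..<b}. card (S \<inter> {t * Q..<(t + 1) * Q}))"
proof -
  have "S \<inter> {a * Q..<b * Q} = (\<Union>t\<in>{a..<b}. S \<inter> {t * Q..<(t + 1) * Q})"
  proof (intro equalityI subsetI)
    fix i assume i: "i \<in> S \<inter> {a * Q..<b * Q}"
    have *: "i div Q * Q + i mod Q = i" "0 \<le> i mod Q" "i mod Q < Q" using assms by auto
    then have "i div Q * Q \<le> i" "i < (i div Q + 1) * Q" unfolding distrib_right by linarith+
    then have "i \<in> {i div Q * Q..<(i div Q + 1) * Q}" by simp
    moreover have "a \<le> i div Q"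
      using zdiv_mono1[of "a * Q" i Q] i assms by auto
    moreover have "i div Q < b"
    proof -
      have "i < b * Q" using i by simp
      then have "i div Q * Q < b * Q" using *(1,2) by linarith
      then show ?thesis by (rule mult_right_less_imp_less) (use assms in simp)
    qed
    ultimately show "i \<in> (\<Union>t\<in>{a..<b}. S \<inter> {t * Q..<(t + 1) * Q})" using i by auto
  next
    fix i assume "i \<in> (\<Union>t\<in>{a..<b}. S \<inter> {t * Q..<(t + 1) * Q})"
    then obtain t where t: "a \<le> t" "t + 1 \<le> b" "i \<in> S" "t * Q \<le> i" "i < (t + 1) * Q" by auto
    have "a * Q \<le> t * Q" "(t + 1) * Q \<le> b * Q" using t assms by (auto intro: mult_right_mono)
    then show "i \<in> S \<inter> {a * Q..<b * Q}" using t by auto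
  qed
  moreover have "S \<inter> {s * Q..<(s + 1) * Q} \<inter> (S \<inter> {t * Q..<(t + 1) * Q}) = {}"
    if "s \<noteq> t" for s t
    using that block_div_mod(1)[where t = s] block_div_mod(1)[where t = t] by blast
  then have "card (\<Union>t\<in>{a..<b}. S \<inter> {t * Q..<(t + 1) * Q}) =
      (\<Sum>t\<in>{a..<b}. card (S \<inter> {t * Q..<(t + 1) * Q}))"
    by (intro card_UN_disjoint) blast+
  ultimately show ?thesis by simp
qed

lemma card_blocks_ge:
  fixes Q :: int and h :: real
  assumes "Q > 0" "A \<subseteq> {a..<b}" "\<And>t. t \<in> A \<Longrightarrow> h \<le> card (S \<inter> {t * Q..<(t + 1) * Q})"
  shows "card A * h \<le> card (S \<inter> {a * Q..<b * Q})"
proof -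
  have "card A * h \<le> (\<Sum>t\<in>A. real (card (S \<inter> {t * Q..<(t + 1) * Q})))"
    using sum_mono[of A "\<lambda>_. h"] assms(3) by (simp add: sum_bounded_below)
  also have "\<dots> \<le> (\<Sum>t\<in>{a..<b}. real (card (S \<inter> {t * Q..<(t + 1) * Q})))"
    using assms(2) by (intro sum_mono2) auto
  also have "\<dots> = card (S \<inter> {a * Q..<b * Q})"
    using card_blocks[OF assms(1), of S a b] by simp
  finally show ?thesis .
qed

lemma card_blocks_le:
  fixes Q :: int and h :: real
  assumes "Q > 0" "a \<le> b" "\<And>t. a \<le> t \<Longrightarrow> t < b \<Longrightarrow> card (S \<inter> {t * Q..<(t + 1) * Q}) \<le> h"
  shows "card (S \<inter> {a * Q..<b * Q}) \<le> of_int (b - a) * h"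
proof -
  have "real (card (S \<inter> {a * Q..<b * Q})) = (\<Sum>t\<in>{a..<b}. real (card (S \<inter> {t * Q..<(t + 1) * Q})))"
    using card_blocks[OF assms(1), of S a b] by simp
  also have "\<dots> \<le> (\<Sum>t\<in>{a..<b}. h)" using assms(3) by (intro sum_mono) auto
  also have "\<dots> = of_int (b - a) * h" using assms(2) by simp
  finally show ?thesis .
qed

lemma card_translate:
  fixes S :: "int set"
  shows "card ({i. i - c \<in> S} \<inter> {u + c..<v + c}) = card (S \<inter> {u..<v})"
proof -
  have "{i. i - c \<in> S} \<inter> {u + c..<v + c} = (\<lambda>i. i + c) ` (S \<inter> {u..<v})"
    by (auto intro!: image_eqI[of _ _ "_ - c"])
  then show ?thesis by (simp add: card_image inj_on_def)
qed

section \<open>Iterated substitutions of constant length\<close>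

text \<open>\<open>T a j\<close> stands for the letter at position \<open>j \<in> {0..<q}\<close> of the word substituted for \<open>a\<close>, and
  \<open>iterated_letter T q n a j\<close> for the one at position \<open>j \<in> {0..<q ^ n}\<close> of its \<open>n\<close>-th iterate.\<close>

primrec iterated_letter :: "('a \<Rightarrow> int \<Rightarrow> 'a) \<Rightarrow> int \<Rightarrow> nat \<Rightarrow> 'a \<Rightarrow> int \<Rightarrow> 'a" where
  "iterated_letter T q 0 a j = a"
| "iterated_letter T q (Suc n) a j = T (iterated_letter T q n a (j div q)) (j mod q)"

lemma iterated_letter_add:
  assumes "q > 0"
  shows "iterated_letter T q (n + k) a j =
    iterated_letter T q k (iterated_letter T q n a (j div q ^ k)) (j mod q ^ k)"
proof (induction k arbitrary: j)
  case (Suc k)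
  have "j div (q * q ^ k) = j div q div q ^ k" using assms by (simp add: zdiv_zmult2_eq)
  moreover have "(j mod (q * q ^ k)) div q = (j div q) mod q ^ k"
    using assms by (simp add: mod_mult_div_eq_div_mod)
  moreover have "(j mod (q * q ^ k)) mod q = j mod q" by (simp add: mod_mod_cancel)
  ultimately show ?case using Suc by simp
qed simp

text \<open>A two-sided sequence fixed by a substitution of constant length \<open>q\<close>.\<close>

locale fixed_sequence =
  fixes q :: int and T :: "'a::finite \<Rightarrow> int \<Rightarrow> 'a" and x :: "int \<Rightarrow> 'a"
  assumes q_ge_2: "2 \<le> q" and fixed: "x i = T (x (i div q)) (i mod q)"
begin

abbreviation "iter \<equiv> iterated_letter T q"

lemma q_power_pos [simp]: "0 < q ^ n"
  using q_ge_2 by simp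

lemma q_nonzero [simp]: "q \<noteq> 0"
  using q_ge_2 by simp

lemma real_q_power_pos [simp]: "0 < real_of_int q ^ n"
  using q_ge_2 by simp

lemma fixed_iter: "x i = iter n (x (i div q ^ n)) (i mod q ^ n)"
proof (induction n arbitrary: i)
  case (Suc n)
  have "i div (q * q ^ n) = i div q div q ^ n" using q_ge_2 by (simp add: zdiv_zmult2_eq)
  moreover have "(i mod (q * q ^ n)) div q = (i div q) mod q ^ n"
    using q_ge_2 by (simp add: mod_mult_div_eq_div_mod)
  moreover have "(i mod (q * q ^ n)) mod q = i mod q" by (simp add: mod_mod_cancel)
  ultimately show ?case using Suc[of "i div q"] fixed[of i] by simp
qed simp

definition hamming :: "nat \<Rightarrow> 'a \<Rightarrow> 'a \<Rightarrow> nat" where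
  "hamming n a b = card {j \<in> {0..<q ^ n}. iter n a j \<noteq> iter n b j}"

definition rate :: "nat \<Rightarrow> 'a \<Rightarrow> 'a \<Rightarrow> real" where
  "rate n a b = hamming n a b / q ^ n"

lemma hamming_eq_rate: "hamming n a b = rate n a b * q ^ n"
  by (simp add: rate_def)

lemma rate_nonneg: "0 \<le> rate n a b"
  using q_ge_2 by (simp add: rate_def)

lemma card_mismatch_block:
  "card ({i. x i \<noteq> x (i + s * q ^ n)} \<inter> {t * q ^ n..<(t + 1) * q ^ n}) = hamming n (x t) (x (t + s))"
proof -
  have "(i + s * q ^ n) div q ^ n = i div q ^ n + s" "(i + s * q ^ n) mod q ^ n = i mod q ^ n" for i
    by auto
  then have "{i. x i \<noteq> x (i + s * q ^ n)} =
     {i. iter n (x (i div q ^ n)) (i mod q ^ n) \<noteq> iter n (x (i div q ^ n + s)) (i mod q ^ n)}"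
    using fixed_iter[of _ n] by (metis (no_types, lifting))
  then show ?thesis
    using card_block[OF q_power_pos, of "\<lambda>t j. iter n (x t) j \<noteq> iter n (x (t + s)) j" n t]
    by (simp add: hamming_def)
qed

lemma hamming_add:
  "hamming (n + k) a b = (\<Sum>t\<in>{0..<q ^ n}. hamming k (iter n a t) (iter n b t))"
proof -
  let ?S = "{j. iter k (iter n a (j div q ^ k)) (j mod q ^ k) \<noteq> iter k (iter n b (j div q ^ k)) (j mod q ^ k)}"
  have "hamming (n + k) a b = card (?S \<inter> {0 * q ^ k..<q ^ n * q ^ k})"
    using q_ge_2 by (auto simp: hamming_def iterated_letter_add power_add intro!: arg_cong[where f = card])
  also have "\<dots> = (\<Sum>t\<in>{0..<q ^ n}. card (?S \<inter> {t * q ^ k..<(t + 1) * q ^ k}))"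
    by (rule card_blocks) simp
  also have "\<dots> = (\<Sum>t\<in>{0..<q ^ n}. hamming k (iter n a t) (iter n b t))"
    using card_block[OF q_power_pos, of "\<lambda>t j. iter k (iter n a t) j \<noteq> iter k (iter n b t) j" k]
    by (simp add: hamming_def)
  finally show ?thesis .
qed

lemma hamming_refl [simp]: "hamming n a a = 0"
  by (simp add: hamming_def)

lemma rate_sym: "rate n a b = rate n b a"
  by (simp add: rate_def hamming_def eq_commute)

lemma rate_triangle: "rate n a c \<le> rate n a b + rate n b c"
proof -
  have "hamming n a c \<le> card ({j \<in> {0..<q ^ n}. iter n a j \<noteq> iter n b j} \<union>
      {j \<in> {0..<q ^ n}. iter n b j \<noteq> iter n c j})"
    unfolding hamming_def by (intro card_mono finite_UnI finite_Collect_conjI) auto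
  also have "\<dots> \<le> hamming n a b + hamming n b c"
    unfolding hamming_def by (rule card_Un_le)
  finally have "real (hamming n a c) \<le> hamming n a b + hamming n b c" by simp
  then show ?thesis
    using divide_right_mono[OF _ less_imp_le[OF real_q_power_pos[of n]]]
    by (simp add: rate_def flip: add_divide_distrib)
qed

text \<open>The blocks of the \<open>(n + k)\<close>-th images differ only where the letters of the \<open>n\<close>-th images do.\<close>

lemma rate_add_le:
  assumes "\<And>t. t \<in> {0..<q ^ n} \<Longrightarrow> iter n a t \<noteq> iter n b t \<Longrightarrow> rate k (iter n a t) (iter n b t) \<le> c"
  shows "rate (n + k) a b \<le> rate n a b * c"
proof -
  let ?D = "{t \<in> {0..<q ^ n}. iter n a t \<noteq> iter n b t}"
  have "real (hamming (n + k) a b) = (\<Sum>t\<in>{0..<q ^ n}. real (hamming k (iter n a t) (iter n b t)))"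
    by (simp add: hamming_add)
  also have "\<dots> = (\<Sum>t\<in>?D. real (hamming k (iter n a t) (iter n b t)))"
    by (rule sum.mono_neutral_right) auto
  also have "\<dots> \<le> (\<Sum>t\<in>?D. c * q ^ k)"
    using assms real_q_power_pos[of k, THEN less_imp_le]
    by (intro sum_mono) (auto simp: hamming_eq_rate simp del: real_q_power_pos intro!: mult_right_mono)
  also have "\<dots> = hamming n a b * (c * q ^ k)" by (simp add: hamming_def)
  finally show ?thesis
    by (simp add: rate_def field_simps power_add)
qed

lemma rate_le_1: "rate n a b \<le> 1"
proof -
  have "hamming n a b \<le> card {0..<q ^ n}" unfolding hamming_def by (intro card_mono) auto
  then have "int (hamming n a b) \<le> q ^ n" using q_power_pos[of n] by (simp add: le_nat_iff)
  then have "real (hamming n a b) \<le> real_of_int q ^ n"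
    by (metis of_int_le_iff of_int_of_nat_eq of_int_power)
  then show ?thesis by (simp add: rate_def)
qed

lemma rate_decreasing: "n \<le> m \<Longrightarrow> rate m a b \<le> rate n a b"
  using rate_add_le[of n a b "m - n" 1] rate_le_1 by simp

text \<open>As the rate does not increase with \<open>n\<close>, being arbitrarily small for some \<open>n\<close> means that it
  tends to zero.\<close>

definition asymptotic :: "'a \<Rightarrow> 'a \<Rightarrow> bool" where
  "asymptotic a b \<longleftrightarrow> (\<forall>\<epsilon>>0. \<exists>n. rate n a b < \<epsilon>)"

lemma asymptotic_refl: "asymptotic a a"
  by (auto simp: asymptotic_def rate_def)

lemma asymptotic_sym: "asymptotic a b \<Longrightarrow> asymptotic b a"
  by (simp add: asymptotic_def rate_sym)

lemma asymptotic_trans: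
  assumes "asymptotic a b" "asymptotic b c"
  shows "asymptotic a c"
  unfolding asymptotic_def
proof (intro allI impI)
  fix \<epsilon> :: real assume "\<epsilon> > 0"
  then obtain m n where "rate m a b < \<epsilon> / 2" "rate n b c < \<epsilon> / 2"
    using assms unfolding asymptotic_def by (meson half_gt_zero)
  moreover have "rate (max m n) a b \<le> rate m a b" "rate (max m n) b c \<le> rate n b c"
    by (auto intro: rate_decreasing)
  ultimately have "rate (max m n) a c < \<epsilon>" using rate_triangle[of "max m n" a c b] by simp
  then show "\<exists>n. rate n a c < \<epsilon>" ..
qed

text \<open>Each of the \<open>q\<^sup>n\<close> blocks contributes at most the total number of differences, so its rate is at
  most \<open>q\<^sup>n\<close> times the rate of the whole image, and the latter is arbitrarily small.\<close>

lemma asymptotic_iter: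
  assumes "asymptotic a b" "t \<in> {0..<q ^ n}"
  shows "asymptotic (iter n a t) (iter n b t)"
  unfolding asymptotic_def
proof (intro allI impI)
  fix \<epsilon> :: real assume "\<epsilon> > 0"
  then have "\<epsilon> / q ^ n > 0" by simp
  then obtain k where k: "rate k a b < \<epsilon> / q ^ n"
    using assms(1) unfolding asymptotic_def by meson
  have "hamming k (iter n a t) (iter n b t) \<le> hamming (n + k) a b"
    unfolding hamming_add using assms(2) by (intro member_le_sum) auto
  then have "rate k (iter n a t) (iter n b t) \<le> rate (n + k) a b * q ^ n"
    by (simp add: rate_def field_simps power_add)
  also have "\<dots> \<le> rate k a b * q ^ n"
    using real_q_power_pos[of n, THEN less_imp_le] by (intro mult_right_mono rate_decreasing) auto
  also have "\<dots> < \<epsilon>" using k q_power_pos[of n] by (simp add: field_simps)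
  finally show "\<exists>k. rate k (iter n a t) (iter n b t) < \<epsilon>" ..
qed

text \<open>A single \<open>K\<close> makes the rate at most one half for all of the finitely many asymptotic pairs. The
  pairs of letters that remain different after \<open>n K\<close> steps are again asymptotic, so another \<open>K\<close> steps
  halve the rate.\<close>

lemma asymptotic_rate_halves:
  obtains K where "\<And>a b n. asymptotic a b \<Longrightarrow> rate (n * K) a b \<le> (1 / 2) ^ n"
proof -
  have "\<exists>n. asymptotic a b \<longrightarrow> rate n a b \<le> 1 / 2" for a b
    unfolding asymptotic_def by (metis half_gt_zero less_eq_real_def zero_less_one)
  then obtain N where N: "\<And>a b. asymptotic a b \<Longrightarrow> rate (N a b) a b \<le> 1 / 2" by metis
  define K where "K = Max (range (\<lambda>(a, b). N a b))"
  have "N a b \<le> K" for a b unfolding K_def by (rule Max_ge) (auto intro: rev_image_eqI)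
  then have K: "rate K a b \<le> 1 / 2" if "asymptotic a b" for a b
    using N[OF that] rate_decreasing[of "N a b" K a b] by (meson order_trans)
  have "rate (n * K) a b \<le> (1 / 2) ^ n" if "asymptotic a b" for a b n
  proof (induction n)
    case 0
    then show ?case using rate_le_1 by simp
  next
    case (Suc n)
    have "rate (n * K + K) a b \<le> rate (n * K) a b * (1 / 2)"
      by (intro rate_add_le K asymptotic_iter that)
    then show ?case using Suc by (simp add: add.commute)
  qed
  then show ?thesis using that by blast
qed

lemma not_asymptotic_rate_bound:
  obtains \<rho> where "\<rho> > 0" "\<And>a b n. \<not> asymptotic a b \<Longrightarrow> \<rho> \<le> rate n a b"
proof -
  have "\<exists>\<epsilon>>0. \<not> asymptotic a b \<longrightarrow> (\<forall>n. \<epsilon> \<le> rate n a b)" for a b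
    unfolding asymptotic_def by (metis not_le zero_less_one)
  then obtain e where e: "\<And>a b. e a b > 0" "\<And>a b n. \<not> asymptotic a b \<Longrightarrow> e a b \<le> rate n a b"
    by metis
  define \<rho> where "\<rho> = Min (range (\<lambda>(a, b). e a b))"
  have "\<rho> \<le> e a b" for a b unfolding \<rho>_def by (rule Min_le) (auto intro: rev_image_eqI)
  moreover have "\<rho> > 0" unfolding \<rho>_def using e(1) by (subst Min_gr_iff) auto
  ultimately show ?thesis using e(2) that by (meson order_trans)
qed

end

text \<open>Uniform recurrence: every word of the sequence reappears with bounded gaps.\<close>

locale recurrent_fixed_sequence = fixed_sequence +
  assumes recurrent:
    "\<exists>R>0. \<forall>s. \<exists>t. s \<le> t \<and> t < s + int R \<and> (\<forall>j. 0 \<le> j \<and> j \<le> L \<longrightarrow> x (t + j) = x (i0 + j))"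
begin

lemma pair_recurrent:
  assumes "m \<ge> 0"
  shows "\<exists>R>0. \<forall>s. \<exists>t. s \<le> t \<and> t < s + int R \<and> x t = x i \<and> x (t + m) = x (i + m)"
proof -
  obtain R where "R > 0" and
    R: "\<And>s. \<exists>t. s \<le> t \<and> t < s + int R \<and> (\<forall>j. 0 \<le> j \<and> j \<le> m \<longrightarrow> x (t + j) = x (i + j))"
    using recurrent[of m i] by auto
  have "\<exists>t. s \<le> t \<and> t < s + int R \<and> x t = x i \<and> x (t + m) = x (i + m)" for s
  proof -
    from R[of s] obtain t where t: "s \<le> t" "t < s + int R"
      "\<And>j. 0 \<le> j \<Longrightarrow> j \<le> m \<Longrightarrow> x (t + j) = x (i + j)" by auto
    show ?thesis using t(1,2) t(3)[of 0] t(3)[of m] assms by auto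
  qed
  then show ?thesis using \<open>R > 0\<close> by blast
qed

section \<open>Discrete spectrum forces periodicity up to asymptotic letters\<close>

text \<open>The three sets \<open>S1\<close>, \<open>S2\<close>, \<open>S3\<close> of the proof follow one another. Non-asymptotic pairs at distance \<open>m\<close>
  recur with bounded gaps (\<open>S1\<close>). On a block of length \<open>q\<^sup>n\<close> with \<open>x t = x (t + m)\<close>, the sequence
  agrees with its translate by \<open>m q\<^sup>n\<close>, which turns them into non-asymptotic pairs at distance
  \<open>m q\<^sup>n - m\<close> (\<open>S2\<close>). Substituting \<open>r\<close> times gives actual mismatches at distance \<open>q\<^sup>r (m q\<^sup>n - m)\<close>, whose
  number is controlled because the rates of non-asymptotic pairs do not drop below \<open>\<rho>\<close> (\<open>S3\<close>).
  What matters is that \<open>c\<close> depends neither on \<open>n\<close> nor on \<open>r\<close>.\<close>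

lemma mismatch_density:
  assumes "m > 0" and return: "x i0 = x (i0 + m)" and bad: "\<not> asymptotic (x i1) (x (i1 + m))"
  shows "\<exists>e c. e > 0 \<and> c > 0 \<and> (\<forall>n r u. e \<le> n \<longrightarrow> c * real_of_int (2 * q ^ (e + n + r)) \<le>
      card ({i. x i \<noteq> x (i + q ^ r * (m * (q ^ n - 1)))} \<inter> {u..<u + 2 * q ^ (e + n + r)}))"
proof -
  obtain R0 where R0: "R0 > 0"
    "\<And>s. \<exists>t. s \<le> t \<and> t < s + int R0 \<and> x t = x i0 \<and> x (t + m) = x (i0 + m)"
    using pair_recurrent[of m i0] \<open>m > 0\<close> by auto
  obtain R1 where R1: "R1 > 0"
    "\<And>s. \<exists>t. s \<le> t \<and> t < s + int R1 \<and> x t = x i1 \<and> x (t + m) = x (i1 + m)"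
    using pair_recurrent[of m i1] \<open>m > 0\<close> by auto
  obtain \<rho> where \<rho>: "\<rho> > 0" "\<And>a b n. \<not> asymptotic a b \<Longrightarrow> \<rho> \<le> rate n a b"
    using not_asymptotic_rate_bound by blast
  \<comment> \<open>Rounding the gaps up to a power of \<open>q\<close> keeps all blocks aligned.\<close>
  define e where "e = R0 + R1"
  have "int e \<le> 2 ^ e" by (metis of_nat_less_two_power less_imp_le)
  also have "\<dots> \<le> q ^ e" using q_ge_2 by (intro power_mono) auto
  finally have e: "int R0 \<le> q ^ e" "int R1 \<le> q ^ e" by (auto simp: e_def)
  \<comment> \<open>A window of length \<open>2 q\<^sup>e\<^sup>+\<^sup>n\<^sup>+\<^sup>r\<close> contains an aligned one of half the length, in which there are
    at least \<open>q\<^sup>n\<^sup>-\<^sup>e\<close> pairs in \<open>S2\<close> and \<open>\<rho> q\<^sup>r\<close> mismatches for each of them.\<close>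
  define c where "c = \<rho> / (2 * real_of_int q ^ (2 * e))"
  have "e > 0" using R0 by (simp add: e_def)
  moreover have "c > 0" using \<rho>(1) by (simp add: c_def)
  moreover have "c * real_of_int (2 * q ^ (e + n + r)) \<le>
      card ({i. x i \<noteq> x (i + q ^ r * (m * (q ^ n - 1)))} \<inter> {u..<u + 2 * q ^ (e + n + r)})"
    if "e \<le> n" for n r u
  proof -
    define S1 where "S1 = {i. \<not> asymptotic (x i) (x (i + m))}"
    define S2 where "S2 = {i. \<not> asymptotic (x i) (x (i + m * (q ^ n - 1)))}"
    define S3 where "S3 = {i. x i \<noteq> x (i + (m * (q ^ n - 1)) * q ^ r)}"
    have pow: "q ^ n = q ^ (n - e) * q ^ e" using that by (simp flip: power_add)
    have S1: "of_int (q ^ (n - e)) \<le> real (card (S1 \<inter> {t * q ^ n..<(t + 1) * q ^ n}))" for t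
    proof -
      have "(1 :: real) \<le> card (S1 \<inter> {b * q ^ e..<(b + 1) * q ^ e})" for b
      proof -
        obtain i where "b * q ^ e \<le> i" "i < b * q ^ e + int R1" "x i = x i1" "x (i + m) = x (i1 + m)"
          using R1(2)[of "b * q ^ e"] by auto
        then have "i \<in> S1 \<inter> {b * q ^ e..<(b + 1) * q ^ e}"
          using e(2) bad by (auto simp: S1_def distrib_right)
        then have "card (S1 \<inter> {b * q ^ e..<(b + 1) * q ^ e}) > 0"
          by (subst card_gt_0_iff) auto
        then show ?thesis by linarith
      qed
      from card_blocks_ge[OF q_power_pos subset_refl this,
          of "t * q ^ (n - e)" "(t + 1) * q ^ (n - e)"]
      have "card {t * q ^ (n - e)..<(t + 1) * q ^ (n - e)} * (1 :: real) \<le>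
          card (S1 \<inter> {t * q ^ n..<(t + 1) * q ^ n})"
        unfolding pow mult.assoc .
      moreover have "real (card {t * q ^ (n - e)..<(t + 1) * q ^ (n - e)}) = of_int (q ^ (n - e))"
        by (simp add: distrib_right less_imp_le)
      ultimately show ?thesis by simp
    qed
    have S2: "of_int (q ^ (n - e)) \<le> real (card (S2 \<inter> {s * q ^ (e + n) + m..<(s + 1) * q ^ (e + n) + m}))" for s
    proof -
      obtain t where t: "s * q ^ e \<le> t" "t < s * q ^ e + int R0" "x t = x (t + m)"
        using R0(2)[of "s * q ^ e"] return by auto
      have "s * q ^ (e + n) \<le> t * q ^ n"
        using mult_right_mono[OF t(1), of "q ^ n"] by (simp add: power_add mult.assoc less_imp_le)
      moreover have "(t + 1) * q ^ n \<le> (s + 1) * q ^ (e + n)"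
      proof -
        have "t + 1 \<le> (s + 1) * q ^ e" using t(2) e(1) by (simp add: distrib_right)
        from mult_right_mono[OF this, of "q ^ n"] show ?thesis
          by (simp add: power_add mult.assoc less_imp_le)
      qed
      moreover have "i + m \<in> S2" if i: "i \<in> S1" "i \<in> {t * q ^ n..<(t + 1) * q ^ n}" for i
      proof -
        have "i div q ^ n = t" using block_div_mod(1)[OF i(2)] .
        then have "x (i + m * q ^ n) = x i"
          using fixed_iter[of "i + m * q ^ n" n] fixed_iter[of i n] t(3) by (simp add: add.commute)
        then have "x (i + m + m * (q ^ n - 1)) = x i" by (simp add: algebra_simps)
        then show ?thesis using i(1) asymptotic_sym by (auto simp: S1_def S2_def)
      qed
      ultimately have "S1 \<inter> {t * q ^ n..<(t + 1) * q ^ n} \<subseteq>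
          {i. i - (- m) \<in> S2} \<inter> {s * q ^ (e + n) + m + (- m)..<(s + 1) * q ^ (e + n) + m + (- m)}"
        by auto
      then have "card (S1 \<inter> {t * q ^ n..<(t + 1) * q ^ n}) \<le>
          card ({i. i - (- m) \<in> S2} \<inter>
            {s * q ^ (e + n) + m + (- m)..<(s + 1) * q ^ (e + n) + m + (- m)})"
        by (intro card_mono finite_Int) auto
      also have "\<dots> = card (S2 \<inter> {s * q ^ (e + n) + m..<(s + 1) * q ^ (e + n) + m})"
        by (rule card_translate)
      finally have "card (S1 \<inter> {t * q ^ n..<(t + 1) * q ^ n}) \<le>
          card (S2 \<inter> {s * q ^ (e + n) + m..<(s + 1) * q ^ (e + n) + m})" .
      then show ?thesis using S1[of t] by linarith
    qed
    let ?M = "q ^ (e + n + r)"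
    \<comment> \<open>The first aligned window, translated by \<open>m q\<^sup>r\<close>, that starts after \<open>u\<close>.\<close>
    define v where "v = (u - m * q ^ r) div ?M"
    define s where "s = v + 1"
    let ?a = "s * q ^ (e + n) + m" and ?b = "(s + 1) * q ^ (e + n) + m"
    have block: "\<rho> * of_int (q ^ r) \<le> card (S3 \<inter> {i * q ^ r..<(i + 1) * q ^ r})" if "i \<in> S2 \<inter> {?a..<?b}" for i
    proof -
      have "\<rho> \<le> rate r (x i) (x (i + m * (q ^ n - 1)))" using that by (intro \<rho>(2)) (auto simp: S2_def)
      from mult_right_mono[OF this less_imp_le[OF real_q_power_pos[of r]]] show ?thesis
        unfolding S3_def card_mismatch_block hamming_eq_rate by simp
    qed
    have "card (S2 \<inter> {?a..<?b}) * (\<rho> * of_int (q ^ r)) \<le> card (S3 \<inter> {?a * q ^ r..<?b * q ^ r})"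
      by (rule card_blocks_ge[OF q_power_pos Int_lower2 block])
    moreover have "of_int (q ^ (n - e)) * (\<rho> * of_int (q ^ r)) \<le>
        card (S2 \<inter> {?a..<?b}) * (\<rho> * of_int (q ^ r))"
      using \<rho>(1) by (intro mult_right_mono S2) (simp add: less_imp_le)
    moreover have "c * real_of_int (2 * ?M) = of_int (q ^ (n - e)) * (\<rho> * of_int (q ^ r))"
    proof -
      define A B where "A = real_of_int q ^ (n - e)" and "B = real_of_int q ^ e"
      have "real_of_int q ^ (e + n + r) = B * (A * B) * real_of_int q ^ r"
        using that by (simp add: A_def B_def flip: power_add)
      moreover have "real_of_int q ^ (2 * e) = B * B" by (simp add: B_def mult_2 power_add)
      moreover have "B \<noteq> 0" by (simp add: B_def)
      ultimately show ?thesis by (simp add: c_def A_def[symmetric])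
    qed
    moreover have "card (S3 \<inter> {?a * q ^ r..<?b * q ^ r}) \<le> card (S3 \<inter> {u..<u + 2 * ?M})"
    proof (rule card_mono)
      have *: "v * ?M + (u - m * q ^ r) mod ?M = u - m * q ^ r"
        "0 \<le> (u - m * q ^ r) mod ?M" "(u - m * q ^ r) mod ?M < ?M"
        by (simp_all only: v_def div_mult_mod_eq pos_mod_sign pos_mod_bound q_power_pos)
      have "?a * q ^ r = v * ?M + ?M + m * q ^ r"
        "?b * q ^ r = v * ?M + ?M + ?M + m * q ^ r"
        by (simp_all add: s_def algebra_simps power_add)
      with * have "u \<le> ?a * q ^ r" "?b * q ^ r \<le> u + 2 * ?M" by linarith+
      then show "S3 \<inter> {?a * q ^ r..<?b * q ^ r} \<subseteq> S3 \<inter> {u..<u + 2 * ?M}" by auto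
    qed simp
    ultimately have "c * real_of_int (2 * ?M) \<le> card (S3 \<inter> {u..<u + 2 * ?M})" by linarith
    then show ?thesis unfolding S3_def mult.commute[of "m * (q ^ n - 1)"] .
  qed
  ultimately show ?thesis by (intro exI[of _ e] exI[of _ c] conjI allI impI)
qed

section \<open>Gaps between mismatches with a translate\<close>

lemma all_pairs_recurrent:
  obtains R :: int where "R > 0"
    "\<And>i s. \<exists>t. s \<le> t \<and> t < s + R \<and> x t = x i \<and> x (t + 1) = x (i + 1)"
proof -
  have "\<exists>R :: nat. \<forall>i. (x i, x (i + 1)) = p \<longrightarrow>
      (\<forall>s. \<exists>t. s \<le> t \<and> t < s + int R \<and> x t = x i \<and> x (t + 1) = x (i + 1))" for p
  proof (cases "\<exists>i. (x i, x (i + 1)) = p")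
    case True
    then obtain i where i: "(x i, x (i + 1)) = p" by blast
    then show ?thesis using pair_recurrent[of 1 i] by auto metis
  qed auto
  then obtain R :: "'a \<times> 'a \<Rightarrow> nat" where
    R: "\<And>i s. \<exists>t. s \<le> t \<and> t < s + int (R (x i, x (i + 1))) \<and> x t = x i \<and> x (t + 1) = x (i + 1)"
    by metis
  define B where "B = int (Max (range R)) + 1"
  have "int (R p) < B" for p
    unfolding B_def by (simp add: le_imp_less_Suc)
  then have "\<exists>t. s \<le> t \<and> t < s + B \<and> x t = x i \<and> x (t + 1) = x (i + 1)" for i s
    using R[of s i] by (metis add_strict_left_mono order.strict_trans)
  moreover have "B > 0" by (simp add: B_def)
  ultimately show ?thesis using that by blast
qed

text \<open>Take the least \<open>r\<close> with \<open>k \<le> q\<^sup>r\<close>. A mismatch at distance \<open>k\<close> is visible in the images of two adjacent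
  letters, so it reappears wherever this pair does. The pairs recur with gaps of at most \<open>R\<close>, the
  mismatches thus with gaps of at most \<open>(R + 1) q\<^sup>r \<le> (R + 1) q k\<close>.\<close>

lemma mismatch_gap:
  obtains C where "C > 0"
    "\<And>k i0 u. k > 0 \<Longrightarrow> x i0 \<noteq> x (i0 + k) \<Longrightarrow> \<exists>i. u \<le> i \<and> i < u + C * k \<and> x i \<noteq> x (i + k)"
proof -
  obtain R :: int where R: "R > 0"
    "\<And>i s. \<exists>t. s \<le> t \<and> t < s + R \<and> x t = x i \<and> x (t + 1) = x (i + 1)"
    using all_pairs_recurrent by blast
  have "\<exists>i. u \<le> i \<and> i < u + ((R + 1) * q) * k \<and> x i \<noteq> x (i + k)"
    if k: "k > 0" and i0: "x i0 \<noteq> x (i0 + k)" for k i0 u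
  proof -
    have "\<exists>r. k \<le> q ^ r"
    proof -
      have "k = int (nat k)" using k by simp
      also have "\<dots> \<le> 2 ^ nat k" by (metis of_nat_less_two_power less_imp_le)
      also have "\<dots> \<le> q ^ nat k" using q_ge_2 by (intro power_mono) auto
      finally show ?thesis ..
    qed
    define r where "r = (LEAST r. k \<le> q ^ r)"
    define Q where "Q = q ^ r"
    have kQ: "k \<le> Q" unfolding Q_def r_def using \<open>\<exists>r. k \<le> q ^ r\<close> by (rule LeastI_ex)
    have Qk: "Q \<le> q * k"
    proof (cases r)
      case 0
      then show ?thesis using mult_mono[of 1 q 1 k] q_ge_2 k by (simp add: Q_def)
    next
      case (Suc r')
      then have "\<not> k \<le> q ^ r'" unfolding r_def by (metis lessI not_less_Least)
      then show ?thesis using Suc q_ge_2 by (simp add: Q_def)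
    qed
    have Q0: "Q > 0" by (simp add: Q_def)
    define s where "s = i0 mod Q"
    have s: "0 \<le> s" "s < Q" using Q0 by (auto simp: s_def)
    obtain t where t: "u div Q + 1 \<le> t" "t < u div Q + 1 + R"
      "x t = x (i0 div Q)" "x (t + 1) = x (i0 div Q + 1)"
      using R(2)[of "u div Q + 1" "i0 div Q"] by auto
    have same: "x (t * Q + s + l) = x (i0 + l)" if l: "0 \<le> l" "l \<le> Q" for l
    proof -
      have i0: "i0 = i0 div Q * Q + s" by (simp add: s_def)
      have dm: "(b * Q + s + l) div Q = b + (s + l) div Q" "(b * Q + s + l) mod Q = (s + l) mod Q" for b
        using Q0 by (auto simp: add.assoc)
      have "(s + l) div Q * Q + (s + l) mod Q = s + l" "0 \<le> (s + l) mod Q" using Q0 by auto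
      then have "(s + l) div Q * Q < 2 * Q" using s l by linarith
      then have "(s + l) div Q < 2" by (rule mult_right_less_imp_less) (use Q0 in simp)
      then have "(s + l) div Q = 0 \<or> (s + l) div Q = 1"
        using pos_imp_zdiv_nonneg_iff[OF Q0, of "s + l"] s l by linarith
      then have "x (t + (s + l) div Q) = x (i0 div Q + (s + l) div Q)" using t by auto
      then have "x (t * Q + s + l) = x (i0 div Q * Q + s + l)"
        using fixed_iter[of "t * Q + s + l" r] fixed_iter[of "i0 div Q * Q + s + l" r]
        by (simp only: dm flip: Q_def)
      then show ?thesis using i0 by simp
    qed
    have "x (t * Q + s) \<noteq> x (t * Q + s + k)"
      using same[of 0] same[of k] k kQ i0 Q0 by simp
    moreover have "u \<le> t * Q + s" "t * Q + s < u + ((R + 1) * q) * k"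
    proof -
      have *: "u div Q * Q + u mod Q = u" "0 \<le> u mod Q" "u mod Q < Q" using Q0 by auto
      have "(u div Q + 1) * Q \<le> t * Q" using t(1) Q0 by (intro mult_right_mono) auto
      then show "u \<le> t * Q + s" using * s unfolding distrib_right by linarith
      have "(t + 1) * Q \<le> (u div Q + 1 + R) * Q" using t(2) Q0 by (intro mult_right_mono) auto
      then have "t * Q + s < u div Q * Q + (R + 1) * Q" using s unfolding distrib_right by linarith
      also have "\<dots> \<le> u + (R + 1) * Q" using *(1,2) by linarith
      also have "(R + 1) * Q \<le> (R + 1) * (q * k)" using Qk R(1) by (intro mult_left_mono) auto
      finally show "t * Q + s < u + ((R + 1) * q) * k" by (simp add: mult.assoc)
    qed
    ultimately show ?thesis by blast
  qed
  moreover have "(R + 1) * q > 0" using R(1) q_ge_2 by simp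
  ultimately show ?thesis using that[of "(R + 1) * q"] by blast
qed

section \<open>Points of the same phase\<close>

lemma asymptotic_multiple_period:
  assumes "\<And>i. asymptotic (x i) (x (i + m))"
  shows "asymptotic (x i) (x (i + s * m))"
proof -
  have *: "asymptotic (x i) (x (i + int n * m))" for n i
  proof (induction n)
    case (Suc n)
    have "i + int (Suc n) * m = (i + int n * m) + m" by (simp add: algebra_simps)
    then show ?case by (simp only:) (rule asymptotic_trans[OF Suc assms])
  qed (simp add: asymptotic_refl)
  show ?thesis
  proof (cases "s \<ge> 0")
    case True
    then show ?thesis using *[of i "nat s"] by simp
  next
    case False
    then have "i + s * m + int (nat (- s)) * m = i" by simp
    then have "asymptotic (x (i + s * m)) (x i)" using *[of "i + s * m" "nat (- s)"] by (simp only:)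
    then show ?thesis by (rule asymptotic_sym)
  qed
qed

text \<open>The distance \<open>k' - k\<close> is a multiple of \<open>m q\<^sup>n\<close>, so the blocks of length \<open>q\<^sup>n\<close> of the two
  translates are aligned, and corresponding blocks are images of letters at a distance divisible
  by \<open>m\<close>. The term \<open>2 q\<^sup>n\<close> accounts for the incomplete blocks at both ends.\<close>

lemma same_phase_mismatch_count:
  fixes D :: real
  assumes period: "\<And>i. asymptotic (x i) (x (i + m))"
    and D: "\<And>a b. asymptotic a b \<Longrightarrow> rate n a b \<le> D"
    and "N \<ge> 0" "(k' - k) mod (m * q ^ n) = 0"
  shows "card {i \<in> {u..<u + N}. x (i + k) \<noteq> x (i + k')} \<le> D * real_of_int (N + 2 * q ^ n)"
proof -
  let ?Q = "q ^ n"
  obtain s where s: "k' = k + (s * m) * ?Q"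
  proof -
    have "m * q ^ n dvd k' - k" using assms(4) by (rule mod_0_imp_dvd)
    then obtain s where "k' - k = m * q ^ n * s" by (elim dvdE)
    then have "k' = k + (s * m) * ?Q" by (simp add: algebra_simps)
    then show ?thesis by (rule that)
  qed
  let ?S = "{i. x i \<noteq> x (i + (s * m) * ?Q)}"
  let ?a = "(u + k) div ?Q" and ?b = "(u + N + k) div ?Q + 1"
  have D0: "0 \<le> D" using D[OF asymptotic_refl, of "x 0"] rate_nonneg[of n "x 0" "x 0"] by linarith
  have *: "(u + k) div ?Q * ?Q + (u + k) mod ?Q = u + k" "0 \<le> (u + k) mod ?Q" "(u + k) mod ?Q < ?Q"
    "(u + N + k) div ?Q * ?Q + (u + N + k) mod ?Q = u + N + k" "0 \<le> (u + N + k) mod ?Q"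
    "(u + N + k) mod ?Q < ?Q"
    by (simp_all only: div_mult_mod_eq pos_mod_sign pos_mod_bound q_power_pos)
  have "card {i \<in> {u..<u + N}. x (i + k) \<noteq> x (i + k')} = card ((\<lambda>i. i + k) ` {i \<in> {u..<u + N}. x (i + k) \<noteq> x (i + k')})"
    by (rule card_image[symmetric]) (simp add: inj_on_def)
  also have "\<dots> \<le> card (?S \<inter> {?a * ?Q..<?b * ?Q})"
  proof (rule card_mono)
    have "?a * ?Q \<le> u + k" "u + N + k \<le> ?b * ?Q" using * unfolding distrib_right by linarith+
    then show "(\<lambda>i. i + k) ` {i \<in> {u..<u + N}. x (i + k) \<noteq> x (i + k')} \<subseteq> ?S \<inter> {?a * ?Q..<?b * ?Q}"
      by (auto simp: s algebra_simps)
  qed simp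
  finally have "real (card {i \<in> {u..<u + N}. x (i + k) \<noteq> x (i + k')}) \<le> card (?S \<inter> {?a * ?Q..<?b * ?Q})"
    by simp
  also have "\<dots> \<le> real_of_int (?b - ?a) * (D * of_int ?Q)"
  proof (rule card_blocks_le)
    have "?a \<le> (u + N + k) div ?Q" using \<open>N \<ge> 0\<close> by (intro zdiv_mono1) auto
    then show "?a \<le> ?b" by simp
    show "real (card (?S \<inter> {t * ?Q..<(t + 1) * ?Q})) \<le> D * of_int ?Q" for t
      unfolding card_mismatch_block hamming_eq_rate
      using mult_right_mono[OF D[OF asymptotic_multiple_period[OF period, of t s]]
        less_imp_le[OF real_q_power_pos[of n]]] by simp
  qed simp
  also have "\<dots> = D * of_int ((?b - ?a) * ?Q)" by simp
  also have "\<dots> \<le> D * real_of_int (N + 2 * ?Q)"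
  proof -
    have "(?b - ?a) * ?Q \<le> N + 2 * ?Q"
      using * unfolding left_diff_distrib distrib_right by linarith
    then show ?thesis using D0 by (intro mult_left_mono) (simp_all only: of_int_le_iff)
  qed
  finally show ?thesis .
qed

end

section \<open>Substitution sequences as fixed sequences\<close>

lemma block_start_constant_length:
  assumes "\<And>a. length (\<theta> a) = l"
  shows "block_start \<theta> y k = int l * k"
  using assms by (cases "k \<ge> 0") (simp_all add: block_start_def)

lemma subst_seq_constant_length:
  assumes "\<And>a. length (\<theta> a) = l" "l > 0"
  shows "subst_seq \<theta> y n = \<theta> (y (n div int l)) ! nat (n mod int l)"
proof -
  have "(THE k. int l * k \<le> n \<and> n < int l * (k + 1)) = n div int l"
  proof (rule the_equality)
    have "int l * (n div int l) + n mod int l = n" "0 \<le> n mod int l" "n mod int l < int l"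
      using assms(2) by simp_all
    then show "int l * (n div int l) \<le> n \<and> n < int l * (n div int l + 1)"
      unfolding distrib_left by linarith
  next
    fix k assume k: "int l * k \<le> n \<and> n < int l * (k + 1)"
    then show "k = n div int l"
      using block_div_mod(1)[of n k "int l"] by (simp add: mult.commute)
  qed
  moreover have "n - int l * (n div int l) = n mod int l" by (simp add: minus_mult_div_eq_mod)
  ultimately show ?thesis
    by (simp add: subst_seq_def block_start_constant_length[OF assms(1)])
qed

lemma subst_seq_funpow_constant_length:
  assumes "\<And>a. length (\<theta> a) = l" "l > 0"
  shows "(subst_seq \<theta> ^^ p) y n =
    iterated_letter (\<lambda>a j. \<theta> a ! nat j) (int l) p (y (n div int l ^ p)) (n mod int l ^ p)"
proof (induction p arbitrary: n)
  case (Suc p)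
  have "n div (int l * int l ^ p) = n div int l div int l ^ p" by (simp add: zdiv_zmult2_eq)
  moreover have "(n mod (int l * int l ^ p)) div int l = (n div int l) mod int l ^ p"
    using assms(2) by (simp add: mod_mult_div_eq_div_mod)
  moreover have "(n mod (int l * int l ^ p)) mod int l = n mod int l" by (simp add: mod_mod_cancel)
  ultimately show ?case
    using Suc[of "n div int l"] subst_seq_constant_length[OF assms] by simp
qed simp

text \<open>All iterated images of a letter are single letters, but one of them contains the whole alphabet.\<close>

lemma primitive_length_one_trivial:
  fixes \<theta> :: "'a \<Rightarrow> 'a list"
  assumes "primitive_substitution \<theta>" "\<And>a. length (\<theta> a) = 1"
  shows "\<exists>a. (UNIV :: 'a set) = {a}"
proof -
  obtain n where n: "\<And>a. set ((subst_word \<theta> ^^ n) [a]) = UNIV"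
    using assms(1) by (auto simp: primitive_substitution_def)
  have "length (subst_word \<theta> w) = length w" for w
    by (induction w) (simp_all add: subst_word_def assms(2))
  then have "length ((subst_word \<theta> ^^ n) w) = length w" for w
    by (induction n) simp_all
  then obtain b where "(subst_word \<theta> ^^ n) [undefined] = [b]"
    by (metis length_Cons length_0_conv length_Suc_conv list.size(3))
  then show ?thesis using n[of undefined] by auto
qed

section \<open>Phases of points in an orbit closure\<close>

text \<open>The position \<open>k\<close> at which a window of \<open>y\<close> occurs in \<open>x\<close> may depend on the window, but its residue
  can be chosen once and for all: if each of the finitely many residues failed for some window, all of
  them would fail for the largest one.\<close>

lemma orbit_closure_phase:
  assumes "y \<in> orbit_closure x" "K > 0"
  shows "\<exists>c\<in>{0..<K}. \<forall>M::nat. \<exists>k. k mod K = c \<and> (\<forall>i. \<bar>i\<bar> \<le> int M \<longrightarrow> y i = x (i + k))"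
proof (rule ccontr)
  assume "\<not> ?thesis"
  then obtain M :: "int \<Rightarrow> nat" where
    M: "\<And>c k. c \<in> {0..<K} \<Longrightarrow> k mod K = c \<Longrightarrow> \<not> (\<forall>i. \<bar>i\<bar> \<le> int (M c) \<longrightarrow> y i = x (i + k))"
    by metis
  define B where "B = Max (insert 0 (M ` {0..<K}))"
  obtain k where k: "\<And>i. \<bar>i\<bar> \<le> int B \<Longrightarrow> y i = x (i + k)"
    using orbit_closure_window[OF assms(1)] by blast
  have c: "k mod K \<in> {0..<K}" using assms(2) by simp
  then have "M (k mod K) \<le> B" unfolding B_def by (intro Max_ge) auto
  then show False using M[OF c refl] k by auto
qed

text \<open>If \<open>x\<close> has period \<open>k\<close>, its phase modulo \<open>k\<close> determines a point of the orbit closure.\<close>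

lemma infinite_orbit_closure_not_periodic:
  assumes "infinite (orbit_closure x)" "k > 0"
  shows "\<exists>i. x i \<noteq> x (i + k)"
proof (rule ccontr)
  assume "\<not> ?thesis"
  then have per: "x (i + k) = x i" for i by simp
  have per_nat: "x (i + int n * k) = x i" for i n
  proof (induction n)
    case (Suc n)
    have "i + int (Suc n) * k = (i + int n * k) + k" by (simp add: algebra_simps)
    then show ?case by (simp only: per Suc)
  qed simp
  have per_int: "x (i + s * k) = x i" for i s
  proof (cases "s \<ge> 0")
    case True
    then show ?thesis using per_nat[of i "nat s"] by simp
  next
    case False
    then have "i + s * k + int (nat (- s)) * k = i" by simp
    then show ?thesis using per_nat[of "i + s * k" "nat (- s)"] by metis
  qed
  have "orbit_closure x \<subseteq> (\<lambda>c i. x (i + c)) ` {0..<k}"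
  proof
    fix y assume "y \<in> orbit_closure x"
    from orbit_closure_phase[OF this \<open>k > 0\<close>] obtain c where c: "c \<in> {0..<k}"
      "\<And>M::nat. \<exists>l. l mod k = c \<and> (\<forall>i. \<bar>i\<bar> \<le> int M \<longrightarrow> y i = x (i + l))" by blast
    have "y i = x (i + c)" for i
    proof -
      obtain l where l: "l mod k = c" "y i = x (i + l)"
        using c(2)[of "nat \<bar>i\<bar>"] by auto
      have eq: "i + l = (i + c) + (l div k) * k"
        using l(1) by (metis add.assoc add.commute div_mult_mod_eq)
      show ?thesis using l(2) unfolding eq per_int .
    qed
    then have "y = (\<lambda>i. x (i + c))" by (rule ext)
    then show "y \<in> (\<lambda>c i. x (i + c)) ` {0..<k}" using c(1) by (rule image_eqI)
  qed
  then show False using assms(1) finite_surj by blast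
qed

section \<open>From frequencies in windows to invariant measures\<close>

text \<open>By invariance, the measure is the integral over \<open>y\<close> of the frequency of mismatches in a window of
  \<open>y\<close>, and the windows of \<open>y\<close> occur in \<open>x\<close>.\<close>

lemma window_frequency_le_measure:
  fixes x :: "int \<Rightarrow> 'a::{finite, discrete_topology}" and c :: real
  assumes inv: "invariant_prob (orbit_closure x) \<mu>" and "N > 0" "k \<ge> 0"
    and freq: "\<And>u. c * of_int N \<le> card ({i. x i \<noteq> x (i + k)} \<inter> {u..<u + N})"
  shows "c \<le> measure \<mu> {y \<in> space \<mu>. y 0 \<noteq> y k}"
proof -
  interpret prob_space \<mu> using inv by (simp add: invariant_prob_def)
  have "space \<mu> = space (restrict_space borel (orbit_closure x))"
    using inv by (intro sets_eq_imp_space_eq) (simp add: invariant_prob_def)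
  then have space: "space \<mu> = orbit_closure x" by (simp add: space_restrict_space)
  obtain code :: "'a \<Rightarrow> nat" where code: "inj code"
    using finite_imp_inj_to_nat_seg[of "UNIV :: 'a set"] by auto
  let ?D = "{y \<in> space \<mu>. y 0 \<noteq> y k}"
  have "{y \<in> space \<mu>. real (code (y 0)) \<noteq> real (code (y k))} \<in> sets \<mu>"
    by (intro borel_measurable_neq coordinate_function_measurable[OF inv])
  then have D: "?D \<in> sets \<mu>" using code by (simp add: inj_eq)
  let ?f = "indicat_real ?D"
  have fm: "?f \<in> borel_measurable \<mu>" using D by simp
  have fi: "integrable \<mu> ?f"
    using D by (intro integrable_real_indicator) (auto simp: less_top[symmetric])
  have fiS: "integrable \<mu> (\<lambda>y. ?f ((left_shift ^^ i) y))" for i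
    using integral_shift_power(2)[OF inv fm] fi by simp
  have "c * of_int N \<le> (\<Sum>i<nat N. ?f ((left_shift ^^ i) y))" if y: "y \<in> space \<mu>" for y
  proof -
    obtain u where u: "\<And>i. \<bar>i\<bar> \<le> int (nat (N + k)) \<Longrightarrow> y i = x (i + u)"
      using orbit_closure_window y space by blast
    have mem: "(left_shift ^^ i) y \<in> space \<mu>" for i
      using measurable_space[OF shift_power_measurable[OF inv] y] .
    have "({i. x i \<noteq> x (i + k)} \<inter> {u..<u + N}) \<subseteq>
      (\<lambda>i. int i + u) ` {i \<in> {..<nat N}. y (int i) \<noteq> y (int i + k)}"
    proof
      fix i assume i: "i \<in> {i. x i \<noteq> x (i + k)} \<inter> {u..<u + N}"
      then have "y (i - u) = x i" "y (i - u + k) = x (i + k)"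
        using u[of "i - u"] u[of "i - u + k"] \<open>k \<ge> 0\<close> \<open>N > 0\<close> by (auto simp: algebra_simps)
      then show "i \<in> (\<lambda>i. int i + u) ` {i \<in> {..<nat N}. y (int i) \<noteq> y (int i + k)}"
        using i by (intro image_eqI[of _ _ "nat (i - u)"]) auto
    qed
    then have "card ({i. x i \<noteq> x (i + k)} \<inter> {u..<u + N}) \<le> card {i \<in> {..<nat N}. y (int i) \<noteq> y (int i + k)}"
      by (rule surj_card_le[rotated]) simp
    moreover have "real (card {i \<in> {..<nat N}. y (int i) \<noteq> y (int i + k)}) = (\<Sum>i<nat N. ?f ((left_shift ^^ i) y))"
    proof -
      have "(\<Sum>i<nat N. ?f ((left_shift ^^ i) y)) = (\<Sum>i<nat N. if y (int i) \<noteq> y (int i + k) then 1 else 0)"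
        using mem by (intro sum.cong refl) (auto simp: indicator_def left_shift_funpow add.commute)
      also have "\<dots> = real (card {i \<in> {..<nat N}. y (int i) \<noteq> y (int i + k)})"
        by (simp add: sum.If_cases Int_def)
      finally show ?thesis ..
    qed
    ultimately show ?thesis using freq[of u] by linarith
  qed
  then have "(\<integral>y. c * of_int N \<partial>\<mu>) \<le> (\<integral>y. (\<Sum>i<nat N. ?f ((left_shift ^^ i) y)) \<partial>\<mu>)"
    by (intro integral_mono fiS Bochner_Integration.integrable_sum) auto
  also have "\<dots> = (\<Sum>i<nat N. \<integral>y. ?f ((left_shift ^^ i) y) \<partial>\<mu>)"
    by (intro Bochner_Integration.integral_sum fiS)
  also have "\<dots> = of_int N * measure \<mu> ?D"
    using integral_shift_power(1)[OF inv fm] \<open>N > 0\<close>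
    by (simp add: Int_absorb2 Collect_restrict)
  finally show ?thesis using \<open>N > 0\<close> by (simp add: prob_space)
qed

text \<open>Otherwise the differences of the numbers \<open>m q\<^sup>e\<^sup>i\<close> would all have mismatch frequency at least \<open>c\<close>,
  against the almost periodicity given by discrete spectrum.\<close>

lemma discrete_spectrum_imp_asymptotic_period:
  fixes x :: "int \<Rightarrow> 'a::{finite, discrete_topology}"
  assumes "recurrent_fixed_sequence q T x"
    and inv: "invariant_prob (orbit_closure x) \<mu>" and "discrete_spectrum \<mu>"
    and "m > 0" "x i0 = x (i0 + m)"
  shows "fixed_sequence.asymptotic q T (x i) (x (i + m))"
proof (rule ccontr)
  interpret recurrent_fixed_sequence q T x by fact
  assume bad: "\<not> asymptotic (x i) (x (i + m))"
  obtain e c where ec: "e > 0" "c > 0"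
    "\<forall>n r u. e \<le> n \<longrightarrow> c * real_of_int (2 * q ^ (e + n + r)) \<le>
      card ({i. x i \<noteq> x (i + q ^ r * (m * (q ^ n - 1)))} \<inter> {u..<u + 2 * q ^ (e + n + r)})"
    using mismatch_density[OF assms(4,5) bad] by (elim exE conjE) (rule that)
  define k where "k i = nat (m * q ^ (e * i))" for i
  have k: "int (k i) = m * q ^ (e * i)" for i
    using \<open>m > 0\<close> by (simp add: k_def less_imp_le)
  have "mono k"
  proof (rule monoI)
    fix i j :: nat assume "i \<le> j"
    then have "m * q ^ (e * i) \<le> m * q ^ (e * j)"
      using \<open>m > 0\<close> q_ge_2 by (intro mult_left_mono power_increasing) auto
    then show "k i \<le> k j" unfolding k_def by (rule nat_mono)
  qed
  from discrete_spectrum_almost_periodic[OF inv assms(3) this \<open>c > 0\<close>] obtain i j where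
    ij: "i < j" "measure \<mu> {y \<in> space \<mu>. y 0 \<noteq> y (int (k j - k i))} < c" by blast
  define n where "n = e * (j - i)"
  have n: "e \<le> n" "e * j = e * i + n"
    using ij(1) by (auto simp: n_def simp flip: distrib_left)
  have "k i \<le> k j" using \<open>mono k\<close> ij(1) by (simp add: monoD)
  then have kk: "int (k j - k i) = q ^ (e * i) * (m * (q ^ n - 1))"
    by (simp add: of_nat_diff k n(2) power_add algebra_simps)
  have "c \<le> measure \<mu> {y \<in> space \<mu>. y 0 \<noteq> y (int (k j - k i))}"
  proof (rule window_frequency_le_measure[OF inv])
    show "c * real_of_int (2 * q ^ (e + n + e * i)) \<le>
        card ({l. x l \<noteq> x (l + int (k j - k i))} \<inter> {u..<u + 2 * q ^ (e + n + e * i)})" for u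
      unfolding kk by (rule ec(3)[rule_format, OF n(1)])
  qed simp_all
  then show False using ij(2) by simp
qed

section \<open>Separation densities\<close>

text \<open>The distance can only exceed \<open>\<delta>\<close> if the points differ within the window of radius \<open>W\<close>, so each
  mismatch is counted at most \<open>2 W + 1\<close> times.\<close>

lemma sep_density_le:
  fixes D P :: real
  assumes W: "\<forall>x y. (\<forall>i. \<bar>i\<bar> \<le> int W \<longrightarrow> x i = y i) \<longrightarrow> d x y < \<delta>"
    and count: "\<And>u N. card {i \<in> {u..<u + int N}. y i \<noteq> z i} \<le> D * (real N + P)"
  shows "sep_density d \<delta> y z \<le> ereal ((2 * real W + 1) * D)"
proof -
  let ?A = "\<lambda>n. {k. k < n \<and> d ((left_shift ^^ k) y) ((left_shift ^^ k) z) \<ge> \<delta>}"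
  have bound: "real (card (?A n)) \<le> (2 * real W + 1) * (D * (real n + P))" for n
  proof -
    let ?B = "\<lambda>w. {k. k < n \<and> y (int k + w) \<noteq> z (int k + w)}"
    have "?A n \<subseteq> (\<Union>w\<in>{- int W..int W}. ?B w)"
    proof
      fix k assume k: "k \<in> ?A n"
      have "\<exists>i. \<bar>i\<bar> \<le> int W \<and> (left_shift ^^ k) y i \<noteq> (left_shift ^^ k) z i"
        using W[rule_format, of "(left_shift ^^ k) y" "(left_shift ^^ k) z"] k by fastforce
      then obtain i where "\<bar>i\<bar> \<le> int W" "y (int k + i) \<noteq> z (int k + i)"
        by (auto simp: left_shift_funpow add.commute)
      then show "k \<in> (\<Union>w\<in>{- int W..int W}. ?B w)" using k by (auto intro!: bexI[of _ i])
    qed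
    then have "card (?A n) \<le> card (\<Union>w\<in>{- int W..int W}. ?B w)" by (intro card_mono) auto
    also have "\<dots> \<le> (\<Sum>w\<in>{- int W..int W}. card (?B w))" by (rule card_UN_le) simp
    finally have "real (card (?A n)) \<le> (\<Sum>w\<in>{- int W..int W}. real (card (?B w)))"
      by (simp flip: of_nat_sum)
    also have "\<dots> \<le> (\<Sum>w\<in>{- int W..int W}. D * (real n + P))"
    proof (rule sum_mono)
      fix w
      have "card (?B w) = card ((\<lambda>k. int k + w) ` ?B w)"
        by (rule card_image[symmetric]) (simp add: inj_on_def)
      also have "\<dots> \<le> card {i \<in> {w..<w + int n}. y i \<noteq> z i}"
        by (rule card_mono[OF finite_subset[of _ "{w..<w + int n}"]]) auto
      finally show "real (card (?B w)) \<le> D * (real n + P)" using count[of w n] by linarith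
    qed
    also have "\<dots> = (2 * real W + 1) * (D * (real n + P))" by simp
    finally show ?thesis .
  qed
  have "sep_density d \<delta> y z \<le> limsup (\<lambda>n. ereal ((2 * real W + 1) * D + ((2 * real W + 1) * D * P) / real n))"
    unfolding sep_density_def
  proof (rule Limsup_mono)
    show "\<forall>\<^sub>F n in sequentially. ereal (real (card (?A n)) / real n) \<le>
        ereal ((2 * real W + 1) * D + ((2 * real W + 1) * D * P) / real n)"
      using eventually_gt_at_top[of 0]
    proof eventually_elim
      case (elim n)
      have "real (card (?A n)) / real n \<le> (2 * real W + 1) * (D * (real n + P)) / real n"
        using bound by (intro divide_right_mono) auto
      also have "\<dots> = (2 * real W + 1) * D + ((2 * real W + 1) * D * P) / real n"
        using elim by (simp add: field_simps)
      finally show ?case by simp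
    qed
  qed
  also have "(\<lambda>n. (2 * real W + 1) * D + ((2 * real W + 1) * D * P) / real n) \<longlonglongrightarrow> (2 * real W + 1) * D + 0"
    by (intro tendsto_add tendsto_const lim_const_over_n)
  then have "limsup (\<lambda>n. ereal ((2 * real W + 1) * D + ((2 * real W + 1) * D * P) / real n)) = ereal ((2 * real W + 1) * D)"
    by (intro lim_imp_Limsup) auto
  finally show ?thesis .
qed

lemma sep_density_ge:
  fixes G :: int
  assumes d: "\<And>x y. d x y < \<delta> \<Longrightarrow> x 0 = y 0"
    and "G > 0" and gap: "\<And>u. \<exists>i. u \<le> i \<and> i < u + G \<and> y i \<noteq> z i"
  shows "ereal (1 / G) \<le> sep_density d \<delta> y z"
proof -
  let ?A = "\<lambda>n. {k. k < n \<and> d ((left_shift ^^ k) y) ((left_shift ^^ k) z) \<ge> \<delta>}"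
  let ?S = "{i. y i \<noteq> z i}"
  have bound: "real n / G - 1 \<le> card (?A n)" for n
  proof -
    have "(1 :: real) \<le> card (?S \<inter> {t * G..<(t + 1) * G})" for t
    proof -
      obtain i where "t * G \<le> i" "i < t * G + G" "y i \<noteq> z i" using gap by blast
      then have "i \<in> ?S \<inter> {t * G..<(t + 1) * G}" by (simp add: distrib_right)
      then have "card (?S \<inter> {t * G..<(t + 1) * G}) > 0" by (subst card_gt_0_iff) auto
      then show ?thesis by linarith
    qed
    from card_blocks_ge[OF \<open>G > 0\<close> subset_refl[of "{0..<int n div G}"] this]
    have "real (nat (int n div G)) \<le> card (?S \<inter> {0..<int n div G * G})" by simp
    also have "card (?S \<inter> {0..<int n div G * G}) \<le> card (int ` ?A n)"
    proof (rule card_mono)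
      show "?S \<inter> {0..<int n div G * G} \<subseteq> int ` ?A n"
      proof
        fix i assume i: "i \<in> ?S \<inter> {0..<int n div G * G}"
        have "int n div G * G \<le> int n"
          using div_mult_mod_eq[of "int n" G] pos_mod_sign[OF \<open>G > 0\<close>, of "int n"] by linarith
        then have i': "0 \<le> i" "i < int n" "y i \<noteq> z i" using i by auto
        then have "\<not> d ((left_shift ^^ nat i) y) ((left_shift ^^ nat i) z) < \<delta>"
          using d[of "(left_shift ^^ nat i) y" "(left_shift ^^ nat i) z"]
          by (auto simp: left_shift_funpow)
        then show "i \<in> int ` ?A n" using i' by (intro image_eqI[of _ _ "nat i"]) auto
      qed
    qed simp
    also have "card (int ` ?A n) = card (?A n)" by (rule card_image) simp
    finally have "real (nat (int n div G)) \<le> card (?A n)" by simp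
    moreover have "real n / G - 1 \<le> real (nat (int n div G))"
    proof -
      have "real_of_int (int n) / real_of_int G < real_of_int (int n div G) + 1"
        using floor_divide_of_int_eq[of "int n" G, where 'a = real]
        by (metis floor_less_iff less_add_one of_int_1 of_int_add)
      then show ?thesis using \<open>G > 0\<close> by (simp add: pos_imp_zdiv_nonneg_iff)
    qed
    ultimately show ?thesis by linarith
  qed
  have "(\<lambda>n. 1 / G - 1 / real n) \<longlonglongrightarrow> 1 / G - 0"
    by (intro tendsto_diff tendsto_const lim_const_over_n)
  then have "limsup (\<lambda>n. ereal (1 / G - 1 / real n)) = ereal (1 / G)"
    by (intro lim_imp_Limsup) auto
  then have "ereal (1 / G) = limsup (\<lambda>n. ereal (1 / G - 1 / real n))" by simp
  also have "\<dots> \<le> sep_density d \<delta> y z"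
    unfolding sep_density_def
  proof (rule Limsup_mono)
    show "\<forall>\<^sub>F n in sequentially. ereal (1 / G - 1 / real n) \<le> ereal (real (card (?A n)) / real n)"
      using eventually_gt_at_top[of 0]
    proof eventually_elim
      case (elim n)
      have "1 / G - 1 / real n = (real n / G - 1) / real n" using elim by (simp add: field_simps)
      also have "\<dots> \<le> real (card (?A n)) / real n" using bound by (intro divide_right_mono) auto
      finally show ?case by simp
    qed
  qed
  finally show ?thesis .
qed

lemma sep_number_ge_1:
  assumes "x \<in> X"
  shows "1 \<le> sep_number d X \<delta> \<nu>"
proof -
  have "ext_card {x} \<le> sep_number d X \<delta> \<nu>"
    unfolding sep_number_def using assms by (intro SUP_upper) auto
  then show ?thesis by (simp add: ext_card_def one_ereal_def)
qed

text \<open>Elements of a \<open>\<nu>\<close>-separated set have different phases modulo \<open>m q\<^sup>n\<close>.\<close>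

lemma sep_number_le:
  fixes x :: "int \<Rightarrow> 'a::{finite, discrete_topology}" and D :: real
  assumes "recurrent_fixed_sequence q T x" and "m > 0"
    and period: "\<And>i. fixed_sequence.asymptotic q T (x i) (x (i + m))"
    and rate: "\<And>a b. fixed_sequence.asymptotic q T a b \<Longrightarrow> fixed_sequence.rate q T n a b \<le> D"
    and W: "\<forall>x y. (\<forall>i. \<bar>i\<bar> \<le> int W \<longrightarrow> x i = y i) \<longrightarrow> d x y < \<delta>"
    and \<nu>: "(2 * real W + 1) * D < \<nu>"
  shows "sep_number d (orbit_closure x) \<delta> \<nu> \<le> ereal (of_int (m * q ^ n))"
  unfolding sep_number_def
proof (rule SUP_least)
  interpret recurrent_fixed_sequence q T x by fact
  fix Y assume "Y \<in> {Y. Y \<subseteq> orbit_closure x \<and>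
    (\<forall>y\<in>Y. \<forall>z\<in>Y. y \<noteq> z \<longrightarrow> ereal \<nu> \<le> sep_density d \<delta> y z)}"
  then have Y: "Y \<subseteq> orbit_closure x"
    "\<And>y z. y \<in> Y \<Longrightarrow> z \<in> Y \<Longrightarrow> y \<noteq> z \<Longrightarrow> ereal \<nu> \<le> sep_density d \<delta> y z" by auto
  let ?K = "m * q ^ n"
  have K: "?K > 0" using \<open>m > 0\<close> by simp
  have "\<exists>c\<in>{0..<?K}. \<forall>M::nat. \<exists>k. k mod ?K = c \<and> (\<forall>i. \<bar>i\<bar> \<le> int M \<longrightarrow> y i = x (i + k))"
    if "y \<in> Y" for y
    using orbit_closure_phase[OF _ K] that Y(1) by blast
  then obtain c where c: "\<And>y. y \<in> Y \<Longrightarrow> c y \<in> {0..<?K}"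
    "\<And>y M. y \<in> Y \<Longrightarrow> \<exists>k. k mod ?K = c y \<and> (\<forall>i. \<bar>i\<bar> \<le> int M \<longrightarrow> y i = x (i + k))"
    by metis
  have inj: "inj_on c Y"
  proof (rule inj_onI, rule ccontr)
    fix y z assume yz: "y \<in> Y" "z \<in> Y" "c y = c z" "y \<noteq> z"
    have "card {i \<in> {u..<u + int N}. y i \<noteq> z i} \<le> D * (real N + 2 * q ^ n)" for u N
    proof -
      define M where "M = nat \<bar>u\<bar> + N"
      obtain k where k: "k mod ?K = c y" "\<And>i. \<bar>i\<bar> \<le> int M \<Longrightarrow> y i = x (i + k)"
        using c(2)[OF yz(1)] by blast
      obtain k' where k': "k' mod ?K = c y" "\<And>i. \<bar>i\<bar> \<le> int M \<Longrightarrow> z i = x (i + k')"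
        using c(2)[OF yz(2)] yz(3) by metis
      have "y i = x (i + k)" "z i = x (i + k')" if "i \<in> {u..<u + int N}" for i
        using that by (auto intro!: k(2) k'(2) simp: M_def)
      then have "{i \<in> {u..<u + int N}. y i \<noteq> z i} = {i \<in> {u..<u + int N}. x (i + k) \<noteq> x (i + k')}"
        by auto
      moreover have "(k' - k) mod ?K = 0"
        using k(1) k'(1) by (intro dvd_imp_mod_0) (simp only: flip: mod_eq_dvd_iff)
      then have "card {i \<in> {u..<u + int N}. x (i + k) \<noteq> x (i + k')} \<le> D * of_int (int N + 2 * q ^ n)"
        by (intro same_phase_mismatch_count[OF period rate]) auto
      ultimately show ?thesis by simp
    qed
    from sep_density_le[OF W this] have "sep_density d \<delta> y z \<le> ereal ((2 * real W + 1) * D)" .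
    also have "\<dots> < ereal \<nu>" using \<nu> by simp
    also have "\<dots> \<le> sep_density d \<delta> y z" using Y(2) yz by blast
    finally show False by simp
  qed
  have img: "c ` Y \<subseteq> {0..<?K}" using c(1) by auto
  have "finite Y" using inj_on_finite[OF inj img] by simp
  have "card Y \<le> card {0..<?K}" using card_inj_on_le[OF inj img] by simp
  then have "int (card Y) \<le> ?K" using K by (simp add: le_nat_iff)
  then have "real_of_int (int (card Y)) \<le> real_of_int ?K" by (simp only: of_int_le_iff)
  then have "real (card Y) \<le> real_of_int ?K" by (simp only: of_int_of_nat_eq)
  then show "ext_card Y \<le> ereal (of_int ?K)" using \<open>finite Y\<close> by (simp add: ext_card_def)
qed

text \<open>The translates of \<open>x\<close> by \<open>0, \<dots>, M\<close> form a \<open>\<nu>\<close>-separated set: two of them differ by a translation of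
  length at most \<open>M\<close>, so their mismatches have gaps of at most \<open>C M\<close>.\<close>

lemma sep_number_ge:
  fixes x :: "int \<Rightarrow> 'a::{finite, discrete_topology}" and C :: int
  assumes d: "\<And>x y. d x y < \<delta> \<Longrightarrow> x 0 = y 0"
    and "C > 0" and gap: "\<And>k u. k > 0 \<Longrightarrow> \<exists>i. u \<le> i \<and> i < u + C * k \<and> x i \<noteq> x (i + k)"
    and "M > 0" "\<nu> \<le> 1 / (C * real M)"
  shows "ereal (real M + 1) \<le> sep_number d (orbit_closure x) \<delta> \<nu>"
proof -
  define p where "p j i = x (i + int j)" for j :: nat and i
  define G where "G = C * int M"
  have G: "G > 0" using assms by (simp add: G_def)
  have lt: "\<exists>i. u \<le> i \<and> i < u + G \<and> p j i \<noteq> p l i" if "j < l" "l \<le> M" for j l u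
  proof -
    have "int (l - j) > 0" using that by simp
    from gap[OF this, of "u + int j"]
    obtain i where i: "u + int j \<le> i" "i < u + int j + C * int (l - j)" "x i \<noteq> x (i + int (l - j))"
      by blast
    have "C * int (l - j) \<le> G" unfolding G_def using \<open>C > 0\<close> that by (intro mult_left_mono) auto
    moreover have "p j (i - int j) = x i" "p l (i - int j) = x (i + int (l - j))"
      using that by (simp_all add: p_def of_nat_diff algebra_simps)
    moreover have "u \<le> i - int j" using i(1) by simp
    moreover have "i - int j < u + G" using i(2) calculation(1) by linarith
    ultimately show ?thesis using i(3) by (intro exI[of _ "i - int j"]) simp
  qed
  have ne: "\<exists>i. u \<le> i \<and> i < u + G \<and> p j i \<noteq> p l i" if "j \<noteq> l" "j \<le> M" "l \<le> M" for j l u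
    using lt[of j l u] lt[of l j u] that by (cases "j < l") (auto simp: eq_commute)
  have inj: "inj_on p {..M}"
  proof (rule inj_onI, rule ccontr)
    fix j l assume "j \<in> {..M}" "l \<in> {..M}" "p j = p l" "j \<noteq> l"
    then show False using ne[of j l 0] by auto
  qed
  have sep: "ereal \<nu> \<le> sep_density d \<delta> (p j) (p l)" if "j \<noteq> l" "j \<le> M" "l \<le> M" for j l
  proof -
    have "ereal \<nu> \<le> ereal (1 / G)" using assms(5) by (simp add: G_def)
    also have "\<dots> \<le> sep_density d \<delta> (p j) (p l)"
      by (rule sep_density_ge[OF _ G]; (erule d | rule ne[OF that]))
    finally show ?thesis .
  qed
  have "p j \<in> orbit_closure x" for j
    using orbit_subset_orbit_closure[of x "int j"] by (simp add: p_def[abs_def])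
  then have "ext_card (p ` {..M}) \<le> sep_number d (orbit_closure x) \<delta> \<nu>"
    unfolding sep_number_def using sep by (intro SUP_upper) (auto, metis)
  then show ?thesis using inj by (simp add: ext_card_def card_image add.commute)
qed

section \<open>Logarithmic growth rates\<close>

lemma Limsup_log_growth_le:
  fixes S :: "real \<Rightarrow> ereal" and B C m :: real
  assumes "C > 0" "B \<ge> 1" "m \<ge> 1"
    and S1: "\<And>\<nu>. 1 \<le> S \<nu>"
    and S: "\<And>\<nu> n. C * (1 / 2) ^ n < \<nu> \<Longrightarrow> S \<nu> \<le> ereal (m * B ^ n)"
  shows "Limsup (at_right 0) (\<lambda>\<nu>. log_ext (S \<nu>) / ereal (- ln \<nu>)) \<le> ereal (ln B / ln 2 + 1)"
proof (rule Limsup_bounded)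
  \<comment> \<open>\<open>P\<close> collects the terms that do not depend on \<open>\<nu>\<close>; it is absorbed by the summand \<open>1\<close> of the
    claimed bound as soon as \<open>- ln \<nu>\<close> exceeds \<open>P\<close>.\<close>
  define P where "P = ln m + ln B * (ln C / ln 2 + 2)"
  define b where "b = min C (exp (- max 1 \<bar>P\<bar>))"
  show "\<forall>\<^sub>F \<nu> in at_right 0. log_ext (S \<nu>) / ereal (- ln \<nu>) \<le> ereal (ln B / ln 2 + 1)"
  proof (rule eventually_at_rightI)
    show "0 < b" using \<open>C > 0\<close> by (simp add: b_def)
    fix \<nu> :: real assume "\<nu> \<in> {0<..<b}"
    then have \<nu>: "\<nu> > 0" "\<nu> < C" "\<nu> < exp (- max 1 \<bar>P\<bar>)" by (auto simp: b_def)
    from \<nu>(1,3) have "ln \<nu> < - max 1 \<bar>P\<bar>"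
      by (metis ln_exp ln_less_cancel_iff exp_gt_zero)
    then have L: "- ln \<nu> \<ge> 1" "P \<le> - ln \<nu>" by auto
    define w where "w = ln (C / \<nu>) / ln 2"
    have w0: "w \<ge> 0" using \<nu> by (simp add: w_def)
    \<comment> \<open>The least admissible \<open>n\<close>, up to rounding: it exceeds the binary logarithm of \<open>C / \<nu>\<close>.\<close>
    define n where "n = nat \<lceil>w\<rceil> + 1"
    have n: "w < real n" "real n \<le> w + 2" using w0 by (auto simp: n_def) linarith+
    have "ln (C / \<nu>) < real n * ln 2" using n(1) by (simp add: w_def field_simps)
    then have "ln (C / \<nu>) < ln (2 ^ n)" by (simp add: ln_realpow)
    then have "C / \<nu> < 2 ^ n" using \<nu> \<open>C > 0\<close> by (subst (asm) ln_less_cancel_iff) auto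
    then have "C * (1 / 2) ^ n < \<nu>" using \<nu>(1) by (simp add: field_simps power_divide)
    then have Sle: "S \<nu> \<le> ereal (m * B ^ n)" by (rule S)
    then obtain s where s: "S \<nu> = ereal s" "1 \<le> s" "s \<le> m * B ^ n"
      using S1[of \<nu>] by (cases "S \<nu>") (auto simp: one_ereal_def)
    have "ln s \<le> ln (m * B ^ n)" using s by (subst ln_le_cancel_iff) auto
    also have "\<dots> = ln m + real n * ln B"
      using \<open>B \<ge> 1\<close> \<open>m \<ge> 1\<close> by (simp add: ln_mult ln_realpow)
    also have "\<dots> \<le> ln m + (w + 2) * ln B"
      using n(2) \<open>B \<ge> 1\<close> by (intro add_left_mono mult_right_mono) auto
    also have "\<dots> = P + ln B / ln 2 * (- ln \<nu>)"
      using \<nu> \<open>C > 0\<close> by (simp add: P_def w_def ln_div field_simps)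
    also have "\<dots> \<le> (ln B / ln 2 + 1) * (- ln \<nu>)" using L(2) by (simp add: algebra_simps)
    finally have "ln s / (- ln \<nu>) \<le> ln B / ln 2 + 1"
      using L(1) by (subst pos_divide_le_eq) auto
    then show "log_ext (S \<nu>) / ereal (- ln \<nu>) \<le> ereal (ln B / ln 2 + 1)"
      using L(1) by (simp add: log_ext_def s)
  qed
qed

lemma Liminf_log_growth_ge:
  fixes S :: "real \<Rightarrow> ereal" and C :: real
  assumes "C > 0"
    and S: "\<And>\<nu>. 0 < \<nu> \<Longrightarrow> \<nu> < 1 / C \<Longrightarrow> ereal (1 / (C * \<nu>)) \<le> S \<nu>"
  shows "1 \<le> Liminf (at_right 0) (\<lambda>\<nu>. log_ext (S \<nu>) / ereal (- ln \<nu>))"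
proof -
  have "((\<lambda>\<nu>. 1 + ln C / ln \<nu>) \<longlongrightarrow> 1 + 0) (at_right 0)"
    by (intro tendsto_add tendsto_const
        tendsto_divide_0[OF tendsto_const filterlim_at_bot_imp_at_infinity[OF ln_at_0]])
  then have "Liminf (at_right 0) (\<lambda>\<nu>. ereal (1 + ln C / ln \<nu>)) = 1"
    by (intro lim_imp_Liminf) (auto simp: one_ereal_def)
  then have "1 = Liminf (at_right 0) (\<lambda>\<nu>. ereal (1 + ln C / ln \<nu>))" by simp
  also have "\<dots> \<le> Liminf (at_right 0) (\<lambda>\<nu>. log_ext (S \<nu>) / ereal (- ln \<nu>))"
  proof (rule Liminf_mono, rule eventually_at_rightI)
    show "0 < min (1 / C) 1" using \<open>C > 0\<close> by simp
    fix \<nu> :: real assume "\<nu> \<in> {0<..<min (1 / C) 1}"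
    then have \<nu>: "0 < \<nu>" "\<nu> < 1 / C" "\<nu> < 1" by auto
    then have ln: "ln \<nu> < 0" by simp
    have ge1: "1 \<le> 1 / (C * \<nu>)" using \<nu> \<open>C > 0\<close> by (simp add: field_simps)
    have eq: "ln (1 / (C * \<nu>)) / (- ln \<nu>) = 1 + ln C / ln \<nu>"
      using \<nu> \<open>C > 0\<close> ln by (simp add: ln_div ln_mult field_simps)
    show "ereal (1 + ln C / ln \<nu>) \<le> log_ext (S \<nu>) / ereal (- ln \<nu>)"
    proof (cases "S \<nu>")
      case (real s)
      then have "1 / (C * \<nu>) \<le> s" using S[OF \<nu>(1,2)] by simp
      then have "ln (1 / (C * \<nu>)) \<le> ln s" using ge1 by (intro ln_mono) linarith+
      then have "ln (1 / (C * \<nu>)) / (- ln \<nu>) \<le> ln s / (- ln \<nu>)" using ln by (intro divide_right_mono) auto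
      then show ?thesis using real ln unfolding eq by (simp add: log_ext_def)
    next
      case PInf
      then show ?thesis using ln by (simp add: log_ext_def)
    next
      case MInf
      then show ?thesis using S[OF \<nu>(1,2)] by simp
    qed
  qed
  finally show ?thesis .
qed

section \<open>Bounds for the amorphic complexity\<close>

theorem theorem1p2:
  fixes \<theta> :: "'a::{finite, discrete_topology} \<Rightarrow> 'a list"
    and X :: "(int \<Rightarrow> 'a) set"
    and \<mu> :: "(int \<Rightarrow> 'a) measure"
    and d :: "(int \<Rightarrow> 'a) \<Rightarrow> (int \<Rightarrow> 'a) \<Rightarrow> real"
  assumes "is_substitution \<theta>"
    and "primitive_substitution \<theta>"
    and "constant_length \<theta>"
    and "substitution_subshift \<theta> X"
    and "infinite X"
    and "invariant_prob X \<mu>"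
    and "discrete_spectrum \<mu>"
    and "induces_product_topology d"
  shows "1 \<le> lower_ac d X \<and> lower_ac d X \<le> upper_ac d X \<and> upper_ac d X < \<infinity>"
proof -
  obtain l where l: "\<And>a. length (\<theta> a) = l"
    using assms(3) by (auto simp: constant_length_def)
  obtain x p where p: "p > 0" "(subst_seq \<theta> ^^ p) x = x" and X: "X = orbit_closure x"
    and min: "is_minimal_subshift X"
    using assms(4) by (auto simp: substitution_subshift_def)
  have "l \<noteq> 0" using assms(1) l[of undefined] by (auto simp: is_substitution_def)
  moreover have "l \<noteq> 1"
  proof
    assume "l = 1"
    then obtain a where "(UNIV :: 'a set) = {a}"
      using primitive_length_one_trivial[OF assms(2)] l by metis
    then have "y = (\<lambda>_. a)" for y :: "int \<Rightarrow> 'a" by auto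
    then have "X \<subseteq> {\<lambda>_. a}" by auto
    then show False using assms(5) finite_subset by blast
  qed
  ultimately have l2: "l \<ge> 2" by simp
  define q where "q = int l ^ p"
  define T where "T = iterated_letter (\<lambda>a j. \<theta> a ! nat j) (int l) p"
  interpret recurrent_fixed_sequence q T x
  proof
    have "2 ^ 1 \<le> int l ^ 1" using l2 by simp
    also have "\<dots> \<le> q" unfolding q_def using p(1) l2 by (intro power_increasing) auto
    finally show "2 \<le> q" by simp
    show "x i = T (x (i div q)) (i mod q)" for i
      using subst_seq_funpow_constant_length[of \<theta> l p x i] l l2 p(2) by (simp add: T_def q_def)
    show "\<exists>R>0. \<forall>s. \<exists>t. s \<le> t \<and> t < s + int R \<and> (\<forall>j. 0 \<le> j \<and> j \<le> L \<longrightarrow> x (t + j) = x (i0 + j))"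
      for L i0
      using min unfolding X by (rule minimal_uniformly_recurrent)
  qed
  have rec: "recurrent_fixed_sequence q T x" by unfold_locales
  obtain m where m: "m > 0" "x 0 = x (0 + m)"
  proof -
    obtain t where "1 \<le> t" "x t = x 0" using pair_recurrent[of 0 0] by (metis order_refl)
    then show ?thesis by (intro that[of t]) auto
  qed
  have period: "asymptotic (x i) (x (i + m))" for i
    using discrete_spectrum_imp_asymptotic_period[OF rec _ assms(7) m] assms(6) X by simp
  obtain K where K: "\<And>a b n. asymptotic a b \<Longrightarrow> rate (n * K) a b \<le> (1 / 2) ^ n"
    using asymptotic_rate_halves by blast
  have xX: "x \<in> X" using orbit_subset_orbit_closure[of x 0] by (simp add: X)
  have "1 \<le> lower_ac d X"
  proof -
    obtain \<delta> where \<delta>: "\<delta> > 0" "\<And>x y. d x y < \<delta> \<Longrightarrow> x 0 = y 0"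
      using agree_at_origin_if_metric_small[OF assms(8)] by blast
    obtain C where C: "C > 0"
      "\<And>k i0 u. k > 0 \<Longrightarrow> x i0 \<noteq> x (i0 + k) \<Longrightarrow> \<exists>i. u \<le> i \<and> i < u + C * k \<and> x i \<noteq> x (i + k)"
      using mismatch_gap by blast
    have gap: "\<exists>i. u \<le> i \<and> i < u + C * k \<and> x i \<noteq> x (i + k)" if "k > 0" for k u
      using infinite_orbit_closure_not_periodic[of x k] assms(5) X C(2) that by blast
    have "ereal (1 / (C * \<nu>)) \<le> sep_number d X \<delta> \<nu>" if \<nu>: "0 < \<nu>" "\<nu> < 1 / C" for \<nu> :: real
    proof -
      define M where "M = nat \<lfloor>1 / (C * \<nu>)\<rfloor>"
      have "1 \<le> 1 / (C * \<nu>)" using \<nu> C(1) by (simp add: field_simps)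
      then have M: "M > 0" "real M \<le> 1 / (C * \<nu>)" "1 / (C * \<nu>) \<le> real M + 1"
        by (auto simp: M_def) linarith+
      then have nu: "\<nu> \<le> 1 / (C * real M)" using \<nu> C(1) by (simp add: field_simps)
      have "ereal (real M + 1) \<le> sep_number d X \<delta> \<nu>"
        unfolding X by (rule sep_number_ge[OF _ C(1) _ M(1) nu]; (erule \<delta>(2) | erule gap))
      then show ?thesis using M(3) by (meson ereal_less_eq(3) order_trans)
    qed
    then have "1 \<le> Liminf (at_right 0) (\<lambda>\<nu>. log_ext (sep_number d X \<delta> \<nu>) / ereal (- ln \<nu>))"
      using C(1) by (intro Liminf_log_growth_ge[of C]) auto
    also have "\<dots> \<le> lower_ac d X"
      unfolding lower_ac_def using \<delta>(1) by (intro SUP_upper) simp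
    finally show ?thesis .
  qed
  moreover have "lower_ac d X \<le> upper_ac d X"
    unfolding lower_ac_def upper_ac_def
    by (intro SUP_mono') (simp add: Liminf_le_Limsup trivial_limit_at_right_real)
  moreover have "upper_ac d X \<le> ereal (ln (q ^ K) / ln 2 + 1)"
    unfolding upper_ac_def
  proof (rule SUP_least)
    fix \<delta> :: real assume "\<delta> \<in> {0<..}"
    then obtain W where W: "\<forall>x y. (\<forall>i. \<bar>i\<bar> \<le> int W \<longrightarrow> x i = y i) \<longrightarrow> d x y < \<delta>"
      using metric_small_if_agree_on_window[OF assms(8), of \<delta>] by auto
    have "sep_number d X \<delta> \<nu> \<le> ereal (m * real_of_int (q ^ K) ^ n)" if "(2 * real W + 1) * (1 / 2) ^ n < \<nu>" for \<nu> n
      using sep_number_le[of q T x m "n * K" "(1 / 2) ^ n" W d \<delta> \<nu>, OF rec m(1) period K W] that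
      by (simp add: X power_mult mult.commute[of n])
    moreover have "1 \<le> real_of_int (q ^ K)" using q_ge_2 by simp
    ultimately show "Limsup (at_right 0) (\<lambda>\<nu>. log_ext (sep_number d X \<delta> \<nu>) / ereal (- ln \<nu>)) \<le>
        ereal (ln (q ^ K) / ln 2 + 1)"
      using m(1) sep_number_ge_1[OF xX]
      by (intro Limsup_log_growth_le[of "(2 * real W + 1)" _ "real_of_int m"]) auto
  qed
  then have "upper_ac d X < \<infinity>" by (rule order.strict_trans1) simp
  ultimately show ?thesis by blast
qed

end
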